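(* Let $\mathbf{H}\in\mathbb{R}^{m\times n}$ be a known (deterministic) matrix, and let $\mathbf{x}$ (in $\mathbb{R}^n$) and $\mathbf{n}$ (in $\mathbb{R}^m$) be independent random vectors with Gaussian mixture distributions $$\mathbf{x}\sim \sum_{k\in\mathcal{K}}p_k\, \mathcal{N}(\mathbf{u}^{(k)}_{\mathbf{x}},\mathbf{C}^{(k)}_{\mathbf{x}\mathbf{x}}),\qquad \mathbf{n}\sim \sum_{l\in\mathcal{L}}q_l\, \mathcal{N}(\mathbf{u}^{(l)}_{\mathbf{n}},\mathbf{C}^{(l)}_{\mathbf{n}\mathbf{n}}),$$ where $\mathcal{K},\mathcal{L}$ are finite index sets, $p_k\ge 0$, $\sum_k p_k=1$, $q_l\ge 0$, $\sum_l q_l=1$. Assume that for all $k\in\mathcal{K}$, $l\in\mathcal{L}$ the matrix $\mathbf{C}^{(k,l)}_{\mathbf{y}\mathbf{y}}=\mathbf{H}\mathbf{C}^{(k)}_{\mathbf{x}\mathbf{x}}\mathbf{H}^T+\mathbf{C}^{(l)}_{\mathbf{n}\mathbf{n}}$ is invertible. Let $\mathbf{y}=\mathbf{H}\mathbf{x}+\mathbf{n}$. Then: (i) The minimum mean square error (MMSE) estimator of $\mathbf{x}$ given $\mathbf{y}$ is $$\hat{\mathbf{x}}=\sum_{k\in\mathcal{K},\,l\in\mathcal{L}}\alpha^{(k,l)}(\mathbf{y})\left[\mathbf{u}^{(k)}_{\mathbf{x}}+\mathbf{C}^{(k)}_{\mathbf{x}\mathbf{x}}\mathbf{H}^T\left(\mathbf{H}\mathbf{C}^{(k)}_{\mathbf{x}\mathbf{x}}\mathbf{H}^T+\mathbf{C}^{(l)}_{\mathbf{n}\mathbf{n}}\right)^{-1}\left(\mathbf{y}-\mathbf{H}\mathbf{u}^{(k)}_{\mathbf{x}}-\mathbf{u}^{(l)}_{\mathbf{n}}\right)\right],$$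 where $$\alpha^{(k,l)}(\mathbf{y})=\frac{p_kq_l f^{(k,l)}(\mathbf{y})}{\sum_{r\in\mathcal{K},\,s\in\mathcal{L}}p_rq_sf^{(r,s)}(\mathbf{y})}$$ and $f^{(k,l)}$ is the Gaussian probability density function on $\mathbb{R}^m$ with mean $\mathbf{u}^{(k,l)}_{\mathbf{y}}=\mathbf{H}\mathbf{u}^{(k)}_{\mathbf{x}}+\mathbf{u}^{(l)}_{\mathbf{n}}$ and covariance $\mathbf{C}^{(k,l)}_{\mathbf{y}\mathbf{y}}=\mathbf{H}\mathbf{C}^{(k)}_{\mathbf{x}\mathbf{x}}\mathbf{H}^T+\mathbf{C}^{(l)}_{\mathbf{n}\mathbf{n}}$. (ii) The mean square error $\epsilon^2=E\{\|\mathbf{x}-\hat{\mathbf{x}}\|_2^2\}$ of this estimator satisfies $$\sum_{k,l}p_kq_l\,\mathrm{Tr}\left(\mathbf{C}^{(k)}_{\mathbf{x}\mathbf{x}}-\mathbf{C}^{(k)}_{\mathbf{x}\mathbf{x}}\mathbf{H}^T\left(\mathbf{H}\mathbf{C}^{(k)}_{\mathbf{x}\mathbf{x}}\mathbf{H}^T+\mathbf{C}^{(l)}_{\mathbf{n}\mathbf{n}}\right)^{-1}\mathbf{H}\mathbf{C}^{(k)}_{\mathbf{x}\mathbf{x}}\right)\le\epsilon^2\le\mathrm{Tr}\left(\mathbf{C}_{\mathbf{x}\mathbf{x}}-\mathbf{C}_{\mathbf{x}\mathbf{x}}\mathbf{H}^T\left(\mathbf{H}\mathbf{C}_{\mathbf{x}\mathbf{x}}\mathbf{H}^T+\mathbf{C}_{\mathbf{n}\mathbf{n}}\right)^{-1}\mathbf{H}\mathbf{C}_{\mathbf{x}\mathbf{x}}\right),$$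 where $$\mathbf{C}_{\mathbf{x}\mathbf{x}}=\sum_kp_k\left(\mathbf{C}^{(k)}_{\mathbf{x}\mathbf{x}}+\mathbf{u}^{(k)}_{\mathbf{x}}{\mathbf{u}^{(k)}_{\mathbf{x}}}^T\right)-\mathbf{u}_{\mathbf{x}}\mathbf{u}_{\mathbf{x}}^T,\quad \mathbf{u}_{\mathbf{x}}=\sum_kp_k\mathbf{u}^{(k)}_{\mathbf{x}},$$ $$\mathbf{C}_{\mathbf{n}\mathbf{n}}=\sum_lq_l\left(\mathbf{C}^{(l)}_{\mathbf{n}\mathbf{n}}+\mathbf{u}^{(l)}_{\mathbf{n}}{\mathbf{u}^{(l)}_{\mathbf{n}}}^T\right)-\mathbf{u}_{\mathbf{n}}\mathbf{u}_{\mathbf{n}}^T,\quad \mathbf{u}_{\mathbf{n}}=\sum_lq_l\mathbf{u}^{(l)}_{\mathbf{n}}.$$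
   Context: All vectors are real column vectors. $\mathcal{N}(\mathbf{u},\mathbf{C})$ denotes the Gaussian distribution with mean $\mathbf{u}$ and (symmetric positive semidefinite) covariance matrix $\mathbf{C}$. For a finite index set $\mathcal{K}$ and weights $p_k\ge0$ with $\sum_k p_k=1$, the notation $\mathbf{x}\sim\sum_{k\in\mathcal{K}}p_k\mathcal{N}(\mathbf{u}^{(k)}_{\mathbf{x}},\mathbf{C}^{(k)}_{\mathbf{x}\mathbf{x}})$ means that the law of $\mathbf{x}$ is the convex combination $\sum_k p_kP_k$ of the probability measures $P_k=\mathcal{N}(\mathbf{u}^{(k)}_{\mathbf{x}},\mathbf{C}^{(k)}_{\mathbf{x}\mathbf{x}})$ (a Gaussian mixture, GM, distribution). The MMSE estimator of $\mathbf{x}$ given $\mathbf{y}$ is the (measurable) function of $\mathbf{y}$ minimizing $E\{\|\mathbf{x}-\hat{\mathbf{x}}(\mathbf{y})\|_2^2\}$; equivalently, it is the posterior mean $E\{\mathbf{x}\mid\mathbf{y}\}$ (unique up to almost sure equality). $\mathrm{Tr}(\cdot)$ is the trace. *)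

theory Defs
  imports "HOL-Probability.Probability"
begin

definition pos_semidef :: "real^'n^'n \<Rightarrow> bool" where
  "pos_semidef C \<longleftrightarrow> transpose C = C \<and> (\<forall>v. 0 \<le> v \<bullet> (C *v v))"

text \<open>Density of the Gaussian distribution with mean \<open>u\<close> and invertible covariance \<open>C\<close>.\<close>

definition gaussian_density :: "real^'n \<Rightarrow> real^'n^'n \<Rightarrow> real^'n \<Rightarrow> real" where
  "gaussian_density u C z =
     exp (- ((z - u) \<bullet> (matrix_inv C *v (z - u))) / 2) / sqrt ((2 * pi) ^ CARD('n) * det C)"

definition std_gaussian_measure :: "(real^'n) measure" where
  "std_gaussian_measure = density lborel (\<lambda>z. ennreal (gaussian_density 0 (mat 1) z))"

text \<open>
  The covariance may be singular, so the Gaussian law with mean \<open>u\<close> and covariance \<open>C\<close> cannot be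
  given by a density in general. It is the law of \<open>u + A z\<close> for \<open>z\<close> standard Gaussian and
  \<open>A\<close> any square matrix with \<open>A A\<^sup>T = C\<close>. Such an \<open>A\<close> exists for every positive semidefinite \<open>C\<close>,
  and the law does not depend on which one is chosen: by the polar decomposition two choices differ
  by an orthogonal factor on the right, under which the standard Gaussian law is invariant.
\<close>

definition gaussian_measure :: "real^'n \<Rightarrow> real^'n^'n \<Rightarrow> (real^'n) measure" where
  "gaussian_measure u C =
     distr std_gaussian_measure borel (\<lambda>z. u + (SOME A :: real^'n^'n. A ** transpose A = C) *v z)"

text \<open>The law of the random vector \<open>X\<close> is the convex combination, with weights \<open>p\<close>, of Gaussian laws.\<close>

definition has_gaussian_mixture_law ::
  "'a measure \<Rightarrow> ('a \<Rightarrow> real^'n) \<Rightarrow> 'k set \<Rightarrow> ('k \<Rightarrow> real) \<Rightarrow> ('k \<Rightarrow> real^'n) \<Rightarrow> ('k \<Rightarrow> real^'n^'n) \<Rightarrow> bool"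
where
  "has_gaussian_mixture_law M X K p u C \<longleftrightarrow>
     X \<in> borel_measurable M \<and>
     (\<forall>A\<in>sets borel. measure (distr M borel X) A = (\<Sum>k\<in>K. p k * measure (gaussian_measure (u k) (C k)) A))"

definition mixture_mean :: "'k set \<Rightarrow> ('k \<Rightarrow> real) \<Rightarrow> ('k \<Rightarrow> real^'n) \<Rightarrow> real^'n" where
  "mixture_mean K p u = (\<Sum>k\<in>K. p k *\<^sub>R u k)"

definition outer_product :: "real^'n \<Rightarrow> real^'n \<Rightarrow> real^'n^'n" where
  "outer_product u v = (columnvector u :: real^1^'n) ** (rowvector v :: real^'n^1)"

definition mixture_cov ::
  "'k set \<Rightarrow> ('k \<Rightarrow> real) \<Rightarrow> ('k \<Rightarrow> real^'n) \<Rightarrow> ('k \<Rightarrow> real^'n^'n) \<Rightarrow> real^'n^'n" where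
  "mixture_cov K p u C =
     (\<Sum>k\<in>K. p k *\<^sub>R (C k + outer_product (u k) (u k)))
       - outer_product (mixture_mean K p u) (mixture_mean K p u)"

text \<open>
  The mean square errors are compared as extended nonnegative integrals, so that competitors \<open>h\<close> of
  infinite mean square error are handled correctly (the Bochner integral would give them the value 0).
\<close>

definition is_mmse_estimator ::
  "'a measure \<Rightarrow> ('a \<Rightarrow> real^'n) \<Rightarrow> ('a \<Rightarrow> real^'m) \<Rightarrow> (real^'m \<Rightarrow> real^'n) \<Rightarrow> bool" where
  "is_mmse_estimator M X Y g \<longleftrightarrow>
     g \<in> borel_measurable borel \<and>
     (\<forall>h\<in>borel_measurable borel.
        (\<integral>\<^sup>+ \<omega>. ennreal ((norm (X \<omega> - g (Y \<omega>)))\<^sup>2) \<partial>M) \<le> (\<integral>\<^sup>+ \<omega>. ennreal ((norm (X \<omega> - h (Y \<omega>)))\<^sup>2) \<partial>M))"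

end

theory Submission
  imports Defs
begin

text \<open>
  Condition on the pair \<open>(k, l)\<close> of components that \<open>x\<close> and the noise are drawn from. Inside one pair,
  \<open>x = ux + A z\<close> and \<open>w = un + B z'\<close> with \<open>(z, z')\<close> standard Gaussian and \<open>A A\<^sup>T = Cx\<close>, \<open>B B\<^sup>T = Cn\<close>, so the
  output \<open>y = H x + w\<close> and the residual \<open>x - G(y)\<close> of the linear estimator
  \<open>G(y) = ux + Cx H\<^sup>T Cyy\<^sup>-\<^sup>1 (y - H ux - un)\<close> are both affine in \<open>(z, z')\<close>, and they are uncorrelated. In
  suitable orthonormal coordinates \<open>(a, b)\<close> the output depends on \<open>b\<close> only and the residual on \<open>a\<close> only. Since
  the standard Gaussian measure is invariant under rotations, this gives, for every Borel function \<open>h\<close>,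
  \<open>E \<parallel>x - h(y)\<parallel>\<^sup>2 = Tr (Cx - Cx H\<^sup>T Cyy\<^sup>-\<^sup>1 H Cx) + \<integral> f(y) \<parallel>G(y) - h(y)\<parallel>\<^sup>2 dy\<close>
  within the pair, \<open>f\<close> being the Gaussian density of \<open>y\<close> (lemmas \<open>component_output_density\<close> and
  \<open>component_error_decomposition\<close>).

  Averaging over the pairs with weights \<open>p k * q l\<close> and using, at each point \<open>y\<close>, that a weighted mean of
  squared distances is smallest at the weighted mean (\<open>weighted_parallel_axis\<close>), the error of \<open>h\<close> is the
  error of \<open>xhat\<close>, the mean of the \<open>G\<close>'s weighted by the posterior probabilities of the pairs, plus
  \<open>E\<parallel>xhat(y) - h(y)\<parallel>\<^sup>2\<close> (\<open>mse_pythagoras\<close>). The theorem follows from these two identities between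
  extended nonnegative integrals: \<open>xhat\<close> is optimal, it is almost surely the only optimal estimator because its
  error is finite, its error is at least the average of the traces above, and at most the error of any
  particular \<open>h\<close>. For \<open>h\<close> one takes the best linear estimator for the overall means and
  covariances. Its error is an expectation of a quadratic polynomial, so it is the trace in the upper
  bound (\<open>linear_estimator_mse\<close>).

  Two ingredients about Lebesgue measure and matrices carry this. Rotation invariance, and the factor
  \<open>1 / \<bar>det S\<bar>\<close> by which a linear bijection \<open>S\<close> scales Lebesgue integrals, both come from the uniqueness of
  translation-invariant measures; every positive semidefinite matrix has a factorization \<open>A A\<^sup>T\<close> by Cholesky
  elimination.
\<close>

section \<open>Matrix algebra\<close>

lemma matrix_inv_mult:
  fixes A :: "real^'n^'n"
  assumes "invertible A"
  shows "A ** matrix_inv A = mat 1" "matrix_inv A ** A = mat 1"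
proof -
  have "A ** matrix_inv A = mat 1 \<and> matrix_inv A ** A = mat 1"
    unfolding matrix_inv_def by (rule someI_ex) (use assms in \<open>simp add: invertible_def\<close>)
  then show "A ** matrix_inv A = mat 1" "matrix_inv A ** A = mat 1" by auto
qed

lemma matrix_inv_eq:
  fixes A B :: "real^'n^'n"
  assumes "A ** B = mat 1"
  shows "matrix_inv A = B"
proof -
  have "invertible A" using assms by (auto simp: invertible_def matrix_left_right_inverse)
  then have "matrix_inv A = matrix_inv A ** (A ** B)" "matrix_inv A ** A = mat 1"
    using assms by (simp_all add: matrix_inv_mult)
  then show ?thesis by (simp add: matrix_mul_assoc)
qed

lemma matrix_diff_ldistrib: "A ** (B - C) = A ** B - A ** C"
  for A :: "real^'n^'m" and B C :: "real^'k^'n"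
  by (simp add: matrix_matrix_mult_def vec_eq_iff right_diff_distrib sum_subtractf)

lemma matrix_diff_rdistrib: "(B - C) ** A = B ** A - C ** A"
  for A :: "real^'k^'n" and B C :: "real^'n^'m"
  by (simp add: matrix_matrix_mult_def vec_eq_iff left_diff_distrib sum_subtractf)

lemma matrix_add_rdistrib: "(B + C) ** A = B ** A + C ** A"
  for A :: "real^'k^'n" and B C :: "real^'n^'m"
  by (simp add: matrix_matrix_mult_def vec_eq_iff distrib_right sum.distrib)

lemma transpose_diff: "transpose (A - B) = transpose A - transpose B"
  for A B :: "real^'n^'m"
  by (simp add: transpose_def vec_eq_iff)

lemma transpose_add: "transpose (A + B) = transpose A + transpose B"
  for A B :: "real^'n^'m"
  by (simp add: transpose_def vec_eq_iff)

lemma matrix_vector_mult_uminus: "(- A) *v x = - (A *v x)" for A :: "real^'n^'m"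
  by (simp add: matrix_vector_mult_def vec_eq_iff sum_negf)

lemma inner_matrix_vector_mult: "(A *v x) \<bullet> y = x \<bullet> (transpose A *v y)"
  for A :: "real^'n^'m"
  by (metis dot_lmul_matrix inner_commute vector_transpose_matrix)

text \<open>
  The left-hand side is the covariance of \<open>x - V (H x + w)\<close> for independent \<open>x\<close> and \<open>w\<close> with covariances \<open>C\<close>
  and \<open>N\<close>. Expanding it leaves two mixed terms and a term quadratic in \<open>V\<close>; the optimal gain satisfies
  \<open>V (H C H\<^sup>T + N) = C H\<^sup>T\<close>, which makes the quadratic term cancel one of the mixed ones.
\<close>

lemma linear_estimator_error_covariance:
  fixes H :: "real^'n^'m" and C :: "real^'n^'n" and N :: "real^'m^'m"
  assumes "invertible (H ** C ** transpose H + N)"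
  defines "V \<equiv> C ** transpose H ** matrix_inv (H ** C ** transpose H + N)"
  shows "(mat 1 - V ** H) ** C ** transpose (mat 1 - V ** H) + V ** N ** transpose V = C - V ** H ** C"
proof -
  let ?G = "H ** C ** transpose H"
  have VM: "V ** (?G + N) = C ** transpose H"
    unfolding V_def matrix_mul_assoc[symmetric] by (simp add: matrix_inv_mult(2)[OF assms(1), unfolded matrix_mul_assoc[symmetric]])
  have "(mat 1 - V ** H) ** C ** transpose (mat 1 - V ** H) + V ** N ** transpose V
     = C - V ** H ** C - C ** transpose H ** transpose V + V ** (?G + N) ** transpose V"
    by (simp add: matrix_diff_rdistrib matrix_diff_ldistrib matrix_add_ldistrib matrix_add_rdistrib transpose_diff
        matrix_transpose_mul matrix_mul_assoc)
  then show ?thesis by (simp add: VM)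
qed

section \<open>Positive semidefinite matrices\<close>

text \<open>
  The quadratic polynomial \<open>(u + t v) \<bullet> C (u + t v)\<close> in \<open>t\<close> is nonnegative, so its discriminant is not
  positive.
\<close>

lemma pos_semidef_cauchy_schwarz:
  assumes "pos_semidef C"
  shows "(u \<bullet> (C *v v))\<^sup>2 \<le> (u \<bullet> (C *v u)) * (v \<bullet> (C *v v))"
proof -
  have sym: "v \<bullet> (C *v u) = u \<bullet> (C *v v)"
    using assms unfolding pos_semidef_def
    by (metis inner_matrix_vector_mult inner_commute)
  let ?x = "u \<bullet> (C *v u)" and ?y = "u \<bullet> (C *v v)" and ?a = "v \<bullet> (C *v v)"
  have q: "0 \<le> ?x + 2 * t * ?y + t\<^sup>2 * ?a" for t
  proof -
    have "0 \<le> (u + t *\<^sub>R v) \<bullet> (C *v (u + t *\<^sub>R v))" using assms by (simp add: pos_semidef_def)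
    then show ?thesis
      by (simp add: matrix_vector_right_distrib matrix_vector_mult_scaleR inner_simps sym power2_eq_square algebra_simps)
  qed
  have "0 \<le> ?a" using assms by (simp add: pos_semidef_def)
  show ?thesis
  proof (cases "?a = 0")
    case True
    have "?y = 0"
    proof (rule ccontr)
      \<comment> \<open>Without a quadratic term the polynomial is affine with slope \<open>2 y\<close>; here its value is \<open>-1\<close>.\<close>
      assume "?y \<noteq> 0"
      then show False using q[of "- (?x + 1) / (2 * ?y)"] True by (simp add: field_simps)
    qed
    then show ?thesis using True by simp
  next
    case False
    \<comment> \<open>The minimum of the polynomial is attained at \<open>t = - y / a\<close>.\<close>
    then show ?thesis using q[of "- ?y / ?a"] \<open>0 \<le> ?a\<close> by (simp add: field_simps power2_eq_square)
  qed
qed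

lemma matrix_entry_inner: "axis i 1 \<bullet> (C *v axis j 1) = C $ i $ j" for C :: "real^'n^'m"
  by (simp add: matrix_vector_mult_basis column_def inner_axis')

text \<open>
  Cholesky elimination: if \<open>C $ i $ i > 0\<close>, the rank-one matrix \<open>c c\<^sup>T / (C $ i $ i)\<close>, with \<open>c\<close> the \<open>i\<close>-th
  column of \<open>C\<close>, can be subtracted from \<open>C\<close> without losing semidefiniteness, and this clears the \<open>i\<close>-th row and
  column. The induction is on the number of nonzero diagonal entries. The second conjunct keeps the \<open>i\<close>-th
  column of the factor of the remaining matrix empty, so that \<open>c / sqrt (C $ i $ i)\<close> can be stored there.
\<close>

lemma pos_semidef_factor_aux:
  fixes C :: "real^'n^'n"
  assumes "pos_semidef C"
  shows "\<exists>A. A ** transpose A = C \<and> (\<forall>i j. C $ j $ j = 0 \<longrightarrow> A $ i $ j = 0)"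
  using assms
proof (induction "card {j. C $ j $ j \<noteq> 0}" arbitrary: C rule: less_induct)
  case less
  have sym: "C $ i $ j = C $ j $ i" for i j
    using less.prems unfolding pos_semidef_def transpose_def vec_eq_iff by simp
  have nonneg: "0 \<le> C $ i $ i" for i
    using less.prems unfolding pos_semidef_def by (metis matrix_entry_inner)
  have cs: "(C $ i $ j)\<^sup>2 \<le> C $ i $ i * C $ j $ j" for i j
    using pos_semidef_cauchy_schwarz[OF less.prems, of "axis i 1" "axis j 1"] by (simp add: matrix_entry_inner)
  have cs0: "C $ i $ j = 0" if "C $ j $ j = 0" for i j
    using cs[of i j] that by simp
  show ?case
  proof (cases "\<forall>i. C $ i $ i = 0")
    case True
    then have "C = 0" using cs0 by (simp add: vec_eq_iff)
    then show ?thesis by (intro exI[of _ 0]) (simp add: matrix_matrix_mult_def vec_eq_iff)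
  next
    case False
    then obtain i where "C $ i $ i \<noteq> 0" by auto
    then have pos: "C $ i $ i > 0" using nonneg[of i] by simp
    define C' where "C' = (\<chi> a b. C $ a $ b - C $ a $ i * C $ b $ i / C $ i $ i)"
    have C'v: "v \<bullet> (C' *v v) = v \<bullet> (C *v v) - (v \<bullet> (C *v axis i 1))\<^sup>2 / C $ i $ i" for v
    proof -
      have "v \<bullet> (C' *v v) = v \<bullet> (C *v v) - (\<Sum>a\<in>UNIV. \<Sum>b\<in>UNIV. v$a * C$a$i * (v$b * C$b$i) / C$i$i)"
        by (simp add: C'_def inner_vec_def matrix_vector_mult_def left_diff_distrib right_diff_distrib
            sum_subtractf sum_distrib_left mult.assoc mult.left_commute mult.commute)
      also have "(\<Sum>a\<in>UNIV. \<Sum>b\<in>UNIV. v$a * C$a$i * (v$b * C$b$i) / C$i$i) = (\<Sum>a\<in>UNIV. v$a * C$a$i)\<^sup>2 / C$i$i"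
        by (simp add: power2_eq_square sum_product flip: sum_divide_distrib)
      also have "(\<Sum>a\<in>UNIV. v$a * C$a$i) = v \<bullet> (C *v axis i 1)"
        by (simp add: matrix_vector_mult_basis column_def inner_vec_def)
      finally show ?thesis .
    qed
    have psd: "pos_semidef C'"
      unfolding pos_semidef_def
    proof (intro conjI allI)
      show "transpose C' = C'" by (simp add: C'_def transpose_def vec_eq_iff sym mult.commute)
      show "0 \<le> v \<bullet> (C' *v v)" for v
        using pos_semidef_cauchy_schwarz[OF less.prems, of v "axis i 1"] pos
        by (simp add: C'v matrix_entry_inner pos_divide_le_eq)
    qed
    have C'i: "C' $ i $ i = 0" using pos by (simp add: C'_def)
    have C'j: "C' $ j $ j = 0" if "C $ j $ j = 0" for j
      using that cs0[OF that, of i] by (simp add: C'_def sym[of j i])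
    have "{j. C' $ j $ j \<noteq> 0} \<subset> {j. C $ j $ j \<noteq> 0}" using C'i C'j pos by force
    then have "card {j. C' $ j $ j \<noteq> 0} < card {j. C $ j $ j \<noteq> 0}" by (intro psubset_card_mono) auto
    from less.hyps[OF this psd] obtain A' where A': "A' ** transpose A' = C'"
      "\<And>i j. C' $ j $ j = 0 \<Longrightarrow> A' $ i $ j = 0" by blast
    define A where "A = (\<chi> a b. if b = i then C $ a $ i / sqrt (C $ i $ i) else A' $ a $ b)"
    have "(A ** transpose A) $ a $ b = C $ a $ b" for a b
    proof -
      have "A $ a $ j * A $ b $ j = A' $ a $ j * A' $ b $ j + (if j = i then C$a$i * C$b$i / C$i$i else 0)" for j
        using pos A'(2)[OF C'i] by (simp add: A_def)
      then have "(A ** transpose A) $ a $ b = (A' ** transpose A') $ a $ b + C$a$i * C$b$i / C$i$i"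
        by (simp add: matrix_matrix_mult_def transpose_def sum.distrib)
      then show ?thesis by (simp add: A'(1) C'_def)
    qed
    moreover have "A $ a $ j = 0" if "C $ j $ j = 0" for a j
      using that pos A'(2)[OF C'j[OF that]] by (auto simp: A_def)
    ultimately show ?thesis by (intro exI[of _ A]) (simp add: vec_eq_iff)
  qed
qed

lemma pos_semidef_factor:
  fixes C :: "real^'n^'n"
  assumes "pos_semidef C"
  obtains A :: "real^'n^'n" where "A ** transpose A = C"
  using pos_semidef_factor_aux[OF assms] by blast

text \<open>
  The Cauchy-Schwarz inequality bounds the inner product of \<open>C v\<close> with itself by a multiple of \<open>v \<bullet> C v\<close>.
\<close>

lemma pos_semidef_quadratic_zero:
  assumes "pos_semidef C" "v \<bullet> (C *v v) = 0"
  shows "C *v v = 0"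
  using pos_semidef_cauchy_schwarz[OF assms(1), of "C *v v" v] assms(2) by simp

lemma quadratic_form_congruence_add:
  fixes H :: "real^'n^'m"
  shows "v \<bullet> ((H ** C ** transpose H + N) *v v) = (transpose H *v v) \<bullet> (C *v (transpose H *v v)) + v \<bullet> (N *v v)"
proof -
  have "v \<bullet> (H *v y) = (transpose H *v v) \<bullet> y" for y
    using inner_matrix_vector_mult[of H y v] by (simp add: inner_commute del: vector_transpose_matrix)
  then show ?thesis
    by (simp add: matrix_vector_mult_add_rdistrib inner_add_right matrix_vector_mul_assoc[symmetric]
        del: vector_transpose_matrix)
qed

lemma pos_semidef_congruence_add:
  fixes H :: "real^'n^'m" and C :: "real^'n^'n" and N :: "real^'m^'m"
  assumes "pos_semidef C" "pos_semidef N"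
  shows "pos_semidef (H ** C ** transpose H + N)"
  using assms unfolding pos_semidef_def quadratic_form_congruence_add
  by (simp add: transpose_add matrix_transpose_mul matrix_mul_assoc del: vector_transpose_matrix)

lemma trace_congruence_nonneg:
  fixes D :: "real^'n^'k"
  assumes "pos_semidef C"
  shows "0 \<le> trace (D ** C ** transpose D)"
proof -
  obtain A :: "real^'n^'n" where A: "A ** transpose A = C" by (rule pos_semidef_factor[OF assms])
  have "trace (D ** C ** transpose D) = trace ((D ** A) ** transpose (D ** A))"
    by (simp only: matrix_transpose_mul matrix_mul_assoc A[symmetric])
  then show ?thesis
    by (simp add: trace_def matrix_matrix_mult_def transpose_def sum_nonneg)
qed

section \<open>Lebesgue measure under linear maps\<close>

lemma borel_measurable_linear:
  fixes f :: "'a::euclidean_space \<Rightarrow> 'b::real_normed_vector"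
  assumes "linear f"
  shows "f \<in> borel_measurable borel"
  using assms by (intro borel_measurable_continuous_onI linear_continuous_on linear_conv_bounded_linear[THEN iffD1])

lemma borel_measurable_matrix_vector_mult [measurable]:
  fixes A :: "real^'n^'m"
  shows "f \<in> borel_measurable M \<Longrightarrow> (\<lambda>x. A *v f x) \<in> borel_measurable M"
  by (rule measurable_compose[OF _ borel_measurable_linear]) simp_all

text \<open>
  Uniqueness of Haar measure on a Euclidean space. Both sides are the integral of \<open>1\<^sub>A(x) 1\<^sub>B(x + y)\<close> against
  \<open>N \<otimes> lborel\<close>, computed in the two orders: for fixed \<open>x\<close> the shift by \<open>x\<close> is absorbed by Lebesgue measure, for
  fixed \<open>y\<close> the shift by \<open>y\<close> is absorbed by \<open>N\<close>, which leaves the Lebesgue measure of a reflected translate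
  of \<open>A\<close>.
\<close>

lemma translation_invariant_proportional_lborel:
  fixes N :: "'a::euclidean_space measure"
  assumes "sigma_finite_measure N" and [measurable_cong]: "sets N = sets borel"
    and inv: "\<And>c. distr N borel ((+) c) = N"
    and [measurable]: "A \<in> sets borel" "B \<in> sets borel"
  shows "emeasure N A * emeasure lborel B = emeasure lborel A * emeasure N B"
proof -
  interpret N: sigma_finite_measure N by fact
  interpret pair_sigma_finite lborel N ..
  have shiftN: "(\<integral>\<^sup>+x. g x \<partial>N) = (\<integral>\<^sup>+x. g (c + x) \<partial>N)"
    if [measurable]: "g \<in> borel_measurable borel" for g :: "'a \<Rightarrow> ennreal" and c
    by (subst inv[of c, symmetric]) (simp add: nn_integral_distr)
  have shiftL: "(\<integral>\<^sup>+x. g x \<partial>lborel) = (\<integral>\<^sup>+x. g (c + x) \<partial>lborel)"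
    if [measurable]: "g \<in> borel_measurable borel" for g :: "'a \<Rightarrow> ennreal" and c
    by (subst lborel_distr_plus[of c, symmetric]) (simp add: nn_integral_distr)
  have flipL: "(\<integral>\<^sup>+x. g x \<partial>lborel) = (\<integral>\<^sup>+x. g (c - x) \<partial>lborel)"
    if [measurable]: "g \<in> borel_measurable borel" for g :: "'a \<Rightarrow> ennreal" and c
  proof -
    have "lborel = distr lborel borel ((-) c)"
      using lborel_affine[of "-1" c] by (simp add: density_1)
    then have "(\<integral>\<^sup>+x. g x \<partial>lborel) = (\<integral>\<^sup>+x. g x \<partial>distr lborel borel ((-) c))" by simp
    then show ?thesis by (simp add: nn_integral_distr)
  qed
  have "emeasure N A * emeasure lborel B = (\<integral>\<^sup>+x. \<integral>\<^sup>+y. indicator A x * indicator B y \<partial>lborel \<partial>N)"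
    by (simp add: nn_integral_cmult nn_integral_multc)
  also have "\<dots> = (\<integral>\<^sup>+x. \<integral>\<^sup>+y. indicator A x * indicator B (x + y) \<partial>lborel \<partial>N)"
    by (intro nn_integral_cong shiftL) simp
  also have "\<dots> = (\<integral>\<^sup>+y. \<integral>\<^sup>+x. indicator A x * indicator B (x + y) \<partial>N \<partial>lborel)"
    by (subst Fubini') simp_all
  also have "\<dots> = (\<integral>\<^sup>+y. \<integral>\<^sup>+x. indicator A (- y + x) * indicator B (- y + x + y) \<partial>N \<partial>lborel)"
    by (intro nn_integral_cong shiftN) simp
  also have "\<dots> = (\<integral>\<^sup>+y. \<integral>\<^sup>+x. indicator A (x - y) * indicator B x \<partial>N \<partial>lborel)"
    by simp
  also have "\<dots> = (\<integral>\<^sup>+x. \<integral>\<^sup>+y. indicator A (x - y) * indicator B x \<partial>lborel \<partial>N)"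
    by (subst Fubini') simp_all
  also have "\<dots> = (\<integral>\<^sup>+x. \<integral>\<^sup>+y. indicator A y * indicator B x \<partial>lborel \<partial>N)"
    by (intro nn_integral_cong flipL[symmetric]) simp
  also have "\<dots> = emeasure lborel A * emeasure N B"
    by (simp add: nn_integral_cmult nn_integral_multc)
  finally show ?thesis .
qed

lemma emeasure_lborel_unit_ball:
  "emeasure lborel (ball (0::'a::euclidean_space) 1) \<noteq> 0" "emeasure lborel (ball (0::'a) 1) \<noteq> \<top>"
proof -
  show fin: "emeasure lborel (ball (0::'a) 1) \<noteq> \<top>"
    using emeasure_lborel_ball_finite[of "0::'a" 1] by auto
  show "emeasure lborel (ball (0::'a) 1) \<noteq> 0"
    using content_ball_pos[of 1 "0::'a"] emeasure_eq_ennreal_measure[OF fin] by simp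
qed

text \<open>
  The measure-theoretic modulus of \<open>f\<close>: the push-forward of Lebesgue measure under \<open>f\<close> is \<open>c\<close> times Lebesgue
  measure. For a linear bijection, \<open>c\<close> is the inverse of the absolute determinant.
\<close>

definition scales_volume :: "real \<Rightarrow> ('a::euclidean_space \<Rightarrow> 'a) \<Rightarrow> bool" where
  "scales_volume c f \<longleftrightarrow> c \<ge> 0 \<and> f \<in> borel_measurable borel \<and> (\<forall>g\<in>borel_measurable borel.
     (\<integral>\<^sup>+x. g (f x) \<partial>lborel) = ennreal c * (\<integral>\<^sup>+x. g x \<partial>lborel))"

text \<open>
  The push-forward of Lebesgue measure under a linear bijection is again translation invariant, so it is
  proportional to Lebesgue measure; the unit ball fixes the constant.
\<close>

lemma linear_inj_scales_volume:
  fixes f :: "'a::euclidean_space \<Rightarrow> 'a"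
  assumes "linear f" "inj f"
  obtains c where "scales_volume c f"
    "ennreal c * emeasure lborel (ball (0::'a) 1) = emeasure lborel (f -` ball 0 1)"
proof -
  have m[measurable]: "f \<in> borel_measurable borel"
    by (rule borel_measurable_linear) fact
  obtain h where h: "linear h" "\<And>x. h (f x) = x" "\<And>x. f (h x) = x"
    using linear_injective_isomorphism[OF assms] by metis
  let ?N = "distr lborel borel f"
  obtain K where K: "\<And>x. norm (h x) \<le> norm x * K"
    using h(1) bounded_linear.bounded linear_conv_bounded_linear by metis
  have fin: "emeasure ?N (ball 0 r) < \<infinity>" for r
  proof -
    have "f -` ball 0 r \<subseteq> cball 0 (r * \<bar>K\<bar>)"
    proof
      fix x assume "x \<in> f -` ball 0 r"
      then have "norm (f x) \<le> r" by simp
      have "norm x \<le> norm (f x) * K" using K[of "f x"] h by simp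
      also have "\<dots> \<le> norm (f x) * \<bar>K\<bar>" by (simp add: mult_left_mono)
      also have "\<dots> \<le> r * \<bar>K\<bar>" using \<open>norm (f x) \<le> r\<close> by (simp add: mult_right_mono)
      finally show "x \<in> cball 0 (r * \<bar>K\<bar>)" by simp
    qed
    then have "emeasure lborel (f -` ball 0 r) \<le> emeasure lborel (cball (0::'a) (r * \<bar>K\<bar>))"
      by (rule emeasure_mono) simp
    also have "\<dots> < \<infinity>" by (rule emeasure_lborel_cball_finite)
    finally show ?thesis by (simp add: emeasure_distr)
  qed
  have sf: "sigma_finite_measure ?N"
  proof
    have "(\<Union>n::nat. ball (0::'a) (real n)) = UNIV"
      using reals_Archimedean2 by auto
    then show "\<exists>A. countable A \<and> A \<subseteq> sets ?N \<and> \<Union>A = space ?N \<and> (\<forall>a\<in>A. emeasure ?N a \<noteq> \<infinity>)"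
      using fin by (intro exI[of _ "range (\<lambda>n::nat. ball 0 (real n))"]) (auto simp: less_top)
  qed
  have tr: "distr ?N borel ((+) c) = ?N" for c
  proof -
    have "distr ?N borel ((+) c) = distr lborel borel (\<lambda>x. f (h c + x))"
      by (simp add: distr_distr comp_def linear_add[OF assms(1)] h)
    also have "\<dots> = distr (distr lborel borel ((+) (h c))) borel f"
      by (subst distr_distr) (auto simp: comp_def)
    finally show ?thesis by (simp add: lborel_distr_plus)
  qed
  define c where "c = measure ?N (ball 0 1) / measure lborel (ball (0::'a) 1)"
  have pos: "measure lborel (ball (0::'a) 1) > 0"
    using content_ball_pos[of 1 "0::'a"] by simp
  have e1: "emeasure lborel (ball (0::'a) 1) = ennreal (measure lborel (ball (0::'a) 1))"
    using emeasure_lborel_ball_finite[of "0::'a" 1] by (intro emeasure_eq_ennreal_measure) auto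
  have e2: "emeasure ?N (ball 0 1) = ennreal (measure ?N (ball 0 1))"
    using fin[of 1] by (intro emeasure_eq_ennreal_measure) auto
  have c: "ennreal c * emeasure lborel (ball (0::'a) 1) = emeasure ?N (ball 0 1)"
    using pos by (simp add: c_def e1 e2 flip: ennreal_mult)
  have N: "?N = density lborel (\<lambda>_. ennreal c)"
  proof (rule measure_eqI)
    fix A assume "A \<in> sets ?N"
    then have [measurable]: "A \<in> sets borel" by simp
    have "emeasure ?N A * emeasure lborel (ball (0::'a) 1) = emeasure lborel A * emeasure ?N (ball 0 1)"
      by (rule translation_invariant_proportional_lborel) (auto simp: sf tr)
    also have "\<dots> = (ennreal c * emeasure lborel A) * emeasure lborel (ball (0::'a) 1)"
      by (simp flip: c add: ac_simps)
    finally have "emeasure ?N A = ennreal c * emeasure lborel A"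
      using emeasure_lborel_unit_ball[where 'a='a] by (simp add: ennreal_mult_cancel_left mult.commute[of _ "emeasure lborel (ball 0 1)"])
    then show "emeasure ?N A = emeasure (density lborel (\<lambda>_. ennreal c)) A"
      by (simp add: emeasure_density nn_integral_cmult)
  qed simp
  have "scales_volume c f"
    unfolding scales_volume_def
  proof (intro conjI ballI)
    fix g :: "'a \<Rightarrow> ennreal" assume [measurable]: "g \<in> borel_measurable borel"
    have "(\<integral>\<^sup>+x. g (f x) \<partial>lborel) = (\<integral>\<^sup>+x. g x \<partial>?N)" by (simp add: nn_integral_distr)
    also have "\<dots> = ennreal c * (\<integral>\<^sup>+x. g x \<partial>lborel)"
      unfolding N by (simp add: nn_integral_density nn_integral_cmult)
    finally show "(\<integral>\<^sup>+x. g (f x) \<partial>lborel) = ennreal c * (\<integral>\<^sup>+x. g x \<partial>lborel)" .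
  qed (auto simp: c_def)
  then show thesis
    using that c by (simp add: emeasure_distr)
qed

lemma scales_volume_unique:
  assumes "scales_volume c f" "scales_volume d (f :: 'a::euclidean_space \<Rightarrow> 'a)"
  shows "c = d"
proof -
  have "ennreal c * (\<integral>\<^sup>+x. indicator (ball (0::'a) 1) x \<partial>lborel)
      = ennreal d * (\<integral>\<^sup>+x. indicator (ball (0::'a) 1) x \<partial>lborel)"
    using assms unfolding scales_volume_def by (metis borel_measurable_indicator borel_open open_ball)
  then have "ennreal c = ennreal d"
    using emeasure_lborel_unit_ball[where 'a='a] by (simp add: ennreal_mult_cancel_left mult.commute[of "ennreal _"])
  then show ?thesis using assms by (simp add: scales_volume_def)
qed

lemma scales_volume_comp:
  fixes f g :: "'a::euclidean_space \<Rightarrow> 'a"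
  assumes "scales_volume c f" "scales_volume d g"
  shows "scales_volume (c * d) (f \<circ> g)"
proof -
  have [measurable]: "f \<in> borel_measurable borel" "g \<in> borel_measurable borel"
    using assms by (auto simp: scales_volume_def)
  have "(\<integral>\<^sup>+x. h (f (g x)) \<partial>lborel) = ennreal (c * d) * (\<integral>\<^sup>+x. h x \<partial>lborel)"
    if [measurable]: "h \<in> borel_measurable borel" for h :: "'a \<Rightarrow> ennreal"
  proof -
    have "(\<lambda>x. h (f x)) \<in> borel_measurable borel" by measurable
    then have "(\<integral>\<^sup>+x. h (f (g x)) \<partial>lborel) = ennreal d * (\<integral>\<^sup>+x. h (f x) \<partial>lborel)"
      using assms(2) unfolding scales_volume_def by (elim conjE) (erule bspec[where x="\<lambda>x. h (f x)"])
    also have "(\<integral>\<^sup>+x. h (f x) \<partial>lborel) = ennreal c * (\<integral>\<^sup>+x. h x \<partial>lborel)"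
      using assms(1) that by (simp add: scales_volume_def)
    finally show ?thesis
      using assms by (simp add: scales_volume_def ennreal_mult ac_simps)
  qed
  then show ?thesis
    using assms by (auto simp: scales_volume_def)
qed

text \<open>
  An isometry maps the unit ball to itself, which forces the constant to be 1.
\<close>

lemma orthogonal_scales_volume:
  fixes f :: "'a::euclidean_space \<Rightarrow> 'a"
  assumes "orthogonal_transformation f"
  shows "scales_volume 1 f"
proof -
  obtain c where c: "scales_volume c f"
    "ennreal c * emeasure lborel (ball (0::'a) 1) = emeasure lborel (f -` ball 0 1)"
    using linear_inj_scales_volume orthogonal_transformation_inj orthogonal_transformation_linear assms by metis
  have "f -` ball 0 1 = ball 0 1"
    using assms by (auto simp: orthogonal_transformation)
  then have "ennreal c = 1"
    using c(2) emeasure_lborel_unit_ball[where 'a='a] ennreal_mult_cancel_left[of "emeasure lborel (ball (0::'a) 1)" "ennreal c" 1]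
    by (simp add: mult.commute)
  then show ?thesis using c by simp
qed

lemma diagonal_scales_volume:
  fixes A :: "real^'n^'n"
  assumes "\<And>i j. i \<noteq> j \<Longrightarrow> A$i$j = 0" "det A \<noteq> 0"
  shows "scales_volume (1 / \<bar>det A\<bar>) ((*v) A)"
proof -
  have det: "det A = (\<Prod>i\<in>UNIV. A$i$i)" by (rule det_diagonal) (use assms in auto)
  then have nz: "A$i$i \<noteq> 0" for i using assms(2) by auto
  let ?c = "\<lambda>b::real^'n. \<Sum>i\<in>UNIV. b$i * A$i$i"
  have ci: "?c (axis i 1) = A$i$i" for i
    by (simp add: axis_def if_distrib[of "\<lambda>x. x * _"] cong: if_cong)
  have B: "(Basis::(real^'n) set) = (\<lambda>i. axis i 1) ` UNIV" by (auto simp: Basis_vec_def)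
  have inj: "inj (\<lambda>i. axis i (1::real) :: real^'n)" by (auto simp: inj_on_def axis_eq_axis)
  have A0: "(\<Sum>j\<in>UNIV. A$i$j * x$j) = A$i$i * x$i" for i x
  proof -
    have "(\<Sum>j\<in>UNIV. A$i$j * x$j) = (\<Sum>j\<in>UNIV. if j = i then A$i$i * x$i else 0)"
      using assms(1) by (intro sum.cong) auto
    then show ?thesis by simp
  qed
  have T: "(\<Sum>j\<in>Basis. (?c j * (x \<bullet> j)) *\<^sub>R j) = A *v x" for x
    by (simp add: B sum.reindex[OF inj] ci del: sum.reindex)
       (simp add: vec_eq_iff matrix_vector_mult_def A0 flip: cart_eq_inner_axis, simp add: axis_def if_distrib cong: if_cong)
  have "lborel = density (distr lborel borel (\<lambda>x. 0 + (\<Sum>j\<in>Basis. (?c j * (x \<bullet> j)) *\<^sub>R j))) (\<lambda>_. (\<Prod>j\<in>Basis. \<bar>?c j\<bar>))"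
    by (rule lborel_affine_euclidean) (auto simp: B ci nz)
  also have "(\<Prod>j\<in>Basis. \<bar>?c j\<bar>) = \<bar>det A\<bar>"
    by (simp add: B prod.reindex[OF inj] ci det abs_prod)
  finally have L: "lborel = density (distr lborel borel ((*v) A)) (\<lambda>_. ennreal \<bar>det A\<bar>)"
    by (simp add: T)
  show ?thesis unfolding scales_volume_def
  proof (intro conjI ballI)
    fix g :: "real^'n \<Rightarrow> ennreal" assume [measurable]: "g \<in> borel_measurable borel"
    have "ennreal (1 / \<bar>det A\<bar>) * (\<integral>\<^sup>+x. g x \<partial>lborel) = 
      ennreal (1 / \<bar>det A\<bar>) * (ennreal \<bar>det A\<bar> * (\<integral>\<^sup>+x. g (A *v x) \<partial>lborel))"
      by (subst L) (simp add: nn_integral_density nn_integral_distr nn_integral_cmult)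
    also have "\<dots> = (\<integral>\<^sup>+x. g (A *v x) \<partial>lborel)"
      using assms(2) by (simp add: mult.assoc[symmetric] ennreal_mult[symmetric])
    finally show "(\<integral>\<^sup>+x. g (A *v x) \<partial>lborel) = ennreal (1 / \<bar>det A\<bar>) * (\<integral>\<^sup>+x. g x \<partial>lborel)" ..
  qed auto
qed

lemma orthogonal_matrix_scales_volume:
  fixes A :: "real^'n^'n"
  assumes "orthogonal_matrix A"
  shows "scales_volume (1 / \<bar>det A\<bar>) ((*v) A)"
  using det_orthogonal_matrix[OF assms] orthogonal_scales_volume[of "(*v) A"] assms
  by (auto simp: orthogonal_transformation_matrix)

text \<open>
  Negating coordinate \<open>m\<close> conjugates the shear into its inverse. The modulus is multiplicative and is 1 for the
  reflection, so the modulus of the shear is its own inverse.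
\<close>

lemma shear_scales_volume:
  fixes m n :: "'n::finite"
  assumes "m \<noteq> n"
  defines "E \<equiv> (\<chi> i j. of_bool (i = m \<and> j = n \<or> i = j)) :: real^'n^'n"
  shows "scales_volume (1 / \<bar>det E\<bar>) ((*v) E)"
proof -
  have Ei: "(E *v x) $ i = (if i = m then x$m + x$n else x$i)" for x i
  proof -
    have "(E *v x) $ i = (\<Sum>j\<in>UNIV. (if j = i then x$j else 0) + (if i = m \<and> j = n then x$j else 0))"
      unfolding E_def matrix_vector_mult_def using assms by (auto intro!: sum.cong)
    then show ?thesis by (cases "i = m") (simp_all add: sum.distrib)
  qed
  \<comment> \<open>The reflection that negates coordinate \<open>m\<close>; the shear adds coordinate \<open>n\<close> to it.\<close>
  define D where "D = (\<lambda>x::real^'n. \<chi> i. if i = m then - x$m else x$i)"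
  have D: "orthogonal_transformation D"
    unfolding orthogonal_transformation
  proof (intro conjI allI)
    show "linear D" by (rule linearI) (auto simp: D_def vec_eq_iff)
    show "norm (D v) = norm v" for v
      by (simp add: norm_vec_def D_def L2_set_def if_distrib[of "\<lambda>x. x\<^sup>2"] if_distrib cong: if_cong)
         (rule sum.cong, auto)
  qed
  have inv: "D \<circ> ((*v) E) \<circ> (D \<circ> ((*v) E)) = id"
    using assms(1) by (auto simp: fun_eq_iff vec_eq_iff D_def Ei)
  have inj: "inj ((*v) E)"
    using inv by (metis inj_on_id inj_on_imageI2)
  obtain c where c: "scales_volume c ((*v) E)"
    using linear_inj_scales_volume[OF _ inj] by auto
  have "scales_volume (1 * c * (1 * c)) (D \<circ> ((*v) E) \<circ> (D \<circ> ((*v) E)))"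
    by (intro scales_volume_comp orthogonal_scales_volume D c)
  then have "scales_volume (c * c) (id :: real^'n \<Rightarrow> _)" using inv by simp
  moreover have "scales_volume 1 (id :: real^'n \<Rightarrow> _)" by (simp add: scales_volume_def)
  ultimately have "c * c = 1" using scales_volume_unique by blast
  then have "c = 1" using c by (simp add: scales_volume_def square_eq_1_iff)
  moreover have "det E = 1"
  proof -
    have "E = (\<chi> k. if k = m then row m (mat 1) + 1 *s row n (mat 1) else row k (mat 1))"
      using assms by (auto simp: E_def vec_eq_iff row_def mat_def)
    then show ?thesis using det_row_operation[OF assms(1), of "mat 1 :: real^'n^'n" 1] by simp
  qed
  ultimately show ?thesis using c by simp
qed

text \<open>
  The modulus and the determinant are both multiplicative, so it suffices to compare them on the elementary
  matrices that generate all matrices.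
\<close>

lemma matrix_scales_volume:
  fixes A :: "real^'n^'n"
  assumes "det A \<noteq> 0"
  shows "scales_volume (1 / \<bar>det A\<bar>) ((*v) A)"
  using assms
proof (induction A rule: induct_matrix_elementary_alt)
  case (1 A B)
  then show ?case
    using scales_volume_comp[of "1 / \<bar>det A\<bar>" "(*v) A" "1 / \<bar>det B\<bar>" "(*v) B"]
    by (simp add: det_mul abs_mult comp_def matrix_vector_mul_assoc)
next
  case (2 A i)
  then show ?case by (metis det_zero_row(2) row_def)
next
  case (3 A)
  then show ?case by (intro diagonal_scales_volume)
next
  case (4 m n)
  have "norm ((\<chi> i j. mat 1 $ i $ Transposition.transpose m n j) *v x) = norm x" for x :: "real^'n"
  proof -
    have *: "((\<chi> i j. mat 1 $ i $ Transposition.transpose m n j) *v x) $ i = x $ Transposition.transpose m n i" for i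
    proof -
      have "(if i = Transposition.transpose m n j then x$j else 0) = (if j = Transposition.transpose m n i then x$j else 0)" for j
        by (auto simp: transpose_eq_iff)
      then show ?thesis
       by (simp add: matrix_vector_mult_def mat_def if_distrib[of "\<lambda>x. x * _"] cong: if_cong)
    qed
    have "(\<Sum>i\<in>UNIV. (x $ Transposition.transpose m n i)\<^sup>2) = (\<Sum>i\<in>UNIV. (x $ i)\<^sup>2)"
      by (rule sum.reindex_bij_betw[of "Transposition.transpose m n" UNIV UNIV]) simp
    then show ?thesis by (simp add: norm_vec_def L2_set_def *)
  qed
  then have "orthogonal_transformation ((*v) ((\<chi> i j. mat 1 $ i $ Transposition.transpose m n j) :: real^'n^'n))"
    by (simp add: orthogonal_transformation)
  then show ?case
    by (intro orthogonal_matrix_scales_volume) (simp add: orthogonal_transformation_matrix)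
next
  case (5 m n)
  then show ?case by (intro shear_scales_volume)
qed

section \<open>The standard Gaussian measure of a Euclidean space\<close>

text \<open>
  The standard Gaussian measure is needed on pairs \<open>(real^'n) \<times> (real^'m)\<close> as well as on \<open>real^'n\<close>, hence an
  arbitrary Euclidean space. The product form of the density makes moments reduce to one-dimensional
  integrals; that it depends on the norm only is \<open>std_gauss_density_eq\<close>.
\<close>

definition std_gauss :: "'a::euclidean_space measure" where
  "std_gauss = density lborel (\<lambda>z. ennreal (\<Prod>b\<in>Basis. std_normal_density (z \<bullet> b)))"

lemma sets_std_gauss [simp, measurable_cong]: "sets std_gauss = sets borel"
  and space_std_gauss [simp]: "space std_gauss = UNIV"
  by (simp_all add: std_gauss_def)

lemma std_gauss_density_eq:
  "(\<Prod>b\<in>Basis. std_normal_density (z \<bullet> b)) = exp (- (norm z)\<^sup>2 / 2) / sqrt ((2 * pi) ^ DIM('a))"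
  for z :: "'a::euclidean_space"
proof -
  have "(\<Prod>b\<in>Basis. std_normal_density (z \<bullet> b))
      = (1 / sqrt (2 * pi)) ^ DIM('a) * exp (\<Sum>b\<in>Basis. - (z \<bullet> b)\<^sup>2 / 2)"
    by (simp add: std_normal_density_def prod.distrib exp_sum prod_dividef power_divide)
  also have "(\<Sum>b\<in>Basis. - (z \<bullet> b)\<^sup>2 / 2) = - (norm z)\<^sup>2 / 2"
    by (simp add: norm_eq_sqrt_inner euclidean_inner[of z z] sum_nonneg sum_negf power2_eq_square flip: sum_divide_distrib)
  finally show ?thesis
    by (simp only: real_sqrt_power power_divide power_one) simp
qed

lemma std_gaussian_measure_eq: "std_gaussian_measure = (std_gauss :: (real^'n) measure)"
  unfolding std_gaussian_measure_def std_gauss_def gaussian_density_def std_gauss_density_eq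
  by (simp add: matrix_inv_eq[of "mat 1" "mat 1"] power2_norm_eq_inner)

lemma nn_integral_std_normal_density: "(\<integral>\<^sup>+x. ennreal (std_normal_density x) \<partial>lborel) = 1"
  using prob_space.emeasure_space_1[OF prob_space_normal_density[of 1 0]] by (simp add: emeasure_density)

lemma nn_integral_sq_std_normal_density: "(\<integral>\<^sup>+x. ennreal (x\<^sup>2 * std_normal_density x) \<partial>lborel) = 1"
proof -
  have "has_bochner_integral lborel (\<lambda>x. std_normal_density x * x ^ (2 * 1)) (fact (2 * 1) / (2 ^ 1 * fact 1))"
    by (rule std_normal_moment_even)
  then have "has_bochner_integral lborel (\<lambda>x. x\<^sup>2 * std_normal_density x) 1"
    by (simp add: mult.commute fact_numeral)
  then show ?thesis
    by (subst nn_integral_eq_integral) (auto simp: has_bochner_integral_iff)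
qed

lemma prob_space_std_gauss: "prob_space (std_gauss :: 'a::euclidean_space measure)"
proof
  have "emeasure (std_gauss :: 'a measure) (space std_gauss)
      = (\<integral>\<^sup>+z. (\<Prod>b\<in>Basis. ennreal (std_normal_density (z \<bullet> (b::'a)))) \<partial>lborel)"
    by (simp add: std_gauss_def emeasure_density prod_ennreal)
  also have "\<dots> = (\<Prod>b\<in>(Basis::'a set). (\<integral>\<^sup>+x. ennreal (std_normal_density x) \<partial>lborel))"
    by (rule nn_integral_lborel_prod) auto
  finally show "emeasure (std_gauss :: 'a measure) (space std_gauss) = 1"
    by (simp add: nn_integral_std_normal_density)
qed

interpretation std_gauss: prob_space std_gauss
  by (rule prob_space_std_gauss)

lemma nn_integral_std_gauss_orthogonal:
  fixes f :: "'a::euclidean_space \<Rightarrow> 'a"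
  assumes "orthogonal_transformation f" and [measurable]: "g \<in> borel_measurable borel"
  shows "(\<integral>\<^sup>+z. g (f z) \<partial>std_gauss) = (\<integral>\<^sup>+z. g z \<partial>std_gauss)"
proof -
  have n: "norm (f z) = norm z" for z using assms(1) by (simp add: orthogonal_transformation)
  have [measurable]: "f \<in> borel_measurable borel"
    by (rule borel_measurable_linear) (use assms(1) in \<open>simp add: orthogonal_transformation\<close>)
  let ?d = "\<lambda>z::'a. ennreal (exp (- (norm z)\<^sup>2 / 2) / sqrt ((2 * pi) ^ DIM('a)))"
  have "(\<integral>\<^sup>+z. g (f z) \<partial>std_gauss) = (\<integral>\<^sup>+z. ?d (f z) * g (f z) \<partial>lborel)"
    unfolding std_gauss_def std_gauss_density_eq by (simp add: nn_integral_density n)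
  also have "\<dots> = (\<integral>\<^sup>+z. ?d z * g z \<partial>lborel)"
    using orthogonal_scales_volume[OF assms(1)] unfolding scales_volume_def
    by (auto dest!: bspec[where x="\<lambda>z. ?d z * g z"])
  also have "\<dots> = (\<integral>\<^sup>+z. g z \<partial>std_gauss)"
    unfolding std_gauss_def std_gauss_density_eq by (simp add: nn_integral_density)
  finally show ?thesis .
qed

lemma std_gauss_pair: "std_gauss \<Otimes>\<^sub>M std_gauss = (std_gauss :: ('a::euclidean_space \<times> 'b::euclidean_space) measure)"
proof -
  have "(std_gauss :: 'a measure) \<Otimes>\<^sub>M (std_gauss :: 'b measure) = density (lborel \<Otimes>\<^sub>M lborel)
      (\<lambda>(x, y). ennreal (\<Prod>b\<in>Basis. std_normal_density (x \<bullet> b)) * ennreal (\<Prod>b\<in>Basis. std_normal_density (y \<bullet> b)))"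
    unfolding std_gauss_def
    by (rule pair_measure_density)
       (auto intro: lborel.sigma_finite_measure_axioms std_gauss.sigma_finite_measure_axioms[unfolded std_gauss_def])
  also have "(\<lambda>(x::'a, y::'b). ennreal (\<Prod>b\<in>Basis. std_normal_density (x \<bullet> b)) * ennreal (\<Prod>b\<in>Basis. std_normal_density (y \<bullet> b)))
     = (\<lambda>z. ennreal (\<Prod>b\<in>Basis. std_normal_density (z \<bullet> b)))"
    by (auto simp: fun_eq_iff std_gauss_density_eq norm_Pair power_add real_sqrt_mult
        simp flip: ennreal_mult exp_add) (simp add: divide_simps flip: exp_add)
  finally show ?thesis by (simp add: lborel_prod std_gauss_def)
qed

lemma nn_integral_std_gauss_pair:
  fixes g :: "'a::euclidean_space \<times> 'b::euclidean_space \<Rightarrow> ennreal"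
  assumes [measurable]: "g \<in> borel_measurable borel"
  shows "(\<integral>\<^sup>+v. g v \<partial>std_gauss) = (\<integral>\<^sup>+x. \<integral>\<^sup>+y. g (x, y) \<partial>std_gauss \<partial>std_gauss)"
    and "(\<integral>\<^sup>+v. g v \<partial>std_gauss) = (\<integral>\<^sup>+y. \<integral>\<^sup>+x. g (x, y) \<partial>std_gauss \<partial>std_gauss)"
proof -
  interpret pair_sigma_finite "std_gauss :: 'a measure" "std_gauss :: 'b measure" ..
  have [measurable]: "g \<in> borel_measurable (std_gauss \<Otimes>\<^sub>M std_gauss)"
    by (simp add: std_gauss_pair)
  show "(\<integral>\<^sup>+v. g v \<partial>std_gauss) = (\<integral>\<^sup>+x. \<integral>\<^sup>+y. g (x, y) \<partial>std_gauss \<partial>std_gauss)"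
    unfolding std_gauss_pair[symmetric] by (rule std_gauss.nn_integral_fst[symmetric]) measurable
  show "(\<integral>\<^sup>+v. g v \<partial>std_gauss) = (\<integral>\<^sup>+y. \<integral>\<^sup>+x. g (x, y) \<partial>std_gauss \<partial>std_gauss)"
    unfolding std_gauss_pair[symmetric] by (rule nn_integral_snd[symmetric]) measurable
qed

lemma nn_integral_symmetrize:
  assumes "orthogonal_transformation f" and [measurable]: "g \<in> borel_measurable borel"
  shows "2 * (\<integral>\<^sup>+z. g z \<partial>std_gauss) = (\<integral>\<^sup>+z. g z + g (f z) \<partial>std_gauss)"
proof -
  have [measurable]: "f \<in> borel_measurable borel"
    by (rule borel_measurable_linear) (use assms(1) in \<open>simp add: orthogonal_transformation\<close>)
  show ?thesis
    by (subst nn_integral_add) (auto simp: nn_integral_std_gauss_orthogonal[OF assms(1)] mult_2)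
qed

lemma parallelogram_law_ennreal:
  fixes a b :: "'a::real_inner"
  shows "ennreal ((norm (a + b))\<^sup>2) + ennreal ((norm (a - b))\<^sup>2)
       = 2 * (ennreal ((norm a)\<^sup>2) + ennreal ((norm b)\<^sup>2))"
proof -
  have "(norm (a + b))\<^sup>2 + (norm (a - b))\<^sup>2 = 2 * ((norm a)\<^sup>2 + (norm b)\<^sup>2)"
    by (simp add: power2_norm_eq_inner inner_simps inner_commute)
  then show ?thesis
    by (simp flip: ennreal_plus ennreal_mult'' ennreal_numeral add: ennreal_mult')
qed

text \<open>
  If an isometry \<open>R\<close> changes the sign of \<open>F\<close> and fixes \<open>D\<close>, the cross term of \<open>\<parallel>F + D\<parallel>\<^sup>2\<close> contributes
  nothing. Averaging the integrand with its image under \<open>R\<close> and applying the parallelogram law shows this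
  for extended nonnegative integrals, also when the cross term itself has no integral.
\<close>

lemma nn_integral_norm_sq_add_odd_even:
  fixes F D :: "'a::euclidean_space \<Rightarrow> 'b::euclidean_space"
  assumes R: "orthogonal_transformation R"
    and odd: "\<And>v. F (R v) = - F v" and even: "\<And>v. D (R v) = D v"
    and [measurable]: "F \<in> borel_measurable borel" "D \<in> borel_measurable borel"
  shows "(\<integral>\<^sup>+v. ennreal ((norm (F v + D v))\<^sup>2) \<partial>std_gauss)
       = (\<integral>\<^sup>+v. ennreal ((norm (F v))\<^sup>2) \<partial>std_gauss) + (\<integral>\<^sup>+v. ennreal ((norm (D v))\<^sup>2) \<partial>std_gauss)"
proof -
  have "2 * (\<integral>\<^sup>+v. ennreal ((norm (F v + D v))\<^sup>2) \<partial>std_gauss)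
      = (\<integral>\<^sup>+v. ennreal ((norm (D v + F v))\<^sup>2) + ennreal ((norm (D v - F v))\<^sup>2) \<partial>std_gauss)"
    by (subst nn_integral_symmetrize[OF R]) (auto simp: odd even add.commute)
  also have "\<dots> = 2 * ((\<integral>\<^sup>+v. ennreal ((norm (F v))\<^sup>2) \<partial>std_gauss) + (\<integral>\<^sup>+v. ennreal ((norm (D v))\<^sup>2) \<partial>std_gauss))"
    unfolding parallelogram_law_ennreal by (simp add: nn_integral_cmult nn_integral_add add.commute)
  finally show ?thesis by (simp only: ennreal_mult_cancel_left) simp
qed

lemma orthogonal_transformation_uminus: "orthogonal_transformation (uminus :: 'a::real_inner \<Rightarrow> 'a)"
  by (simp add: orthogonal_transformation_def linear_uminus)

lemma orthogonal_transformation_reflect: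
  assumes "norm e = 1"
  shows "orthogonal_transformation (\<lambda>x. x - (2 * (x \<bullet> e)) *\<^sub>R e)"
proof -
  have [simp]: "e \<bullet> e = 1" using assms by (simp add: norm_eq_1)
  show ?thesis
    unfolding orthogonal_transformation_def
  proof (intro conjI allI)
    show "linear (\<lambda>x. x - (2 * (x \<bullet> e)) *\<^sub>R e)"
      by (rule linearI) (simp_all add: inner_add_left algebra_simps)
    show "(v - (2 * (v \<bullet> e)) *\<^sub>R e) \<bullet> (w - (2 * (w \<bullet> e)) *\<^sub>R e) = v \<bullet> w" for v w
      by (simp add: inner_diff_left inner_diff_right inner_commute[of e v] inner_commute[of e w])
  qed
qed

text \<open>
  The standard Gaussian has identity covariance. On a basis vector the integral factors into one-dimensional
  ones. The coordinates are added one at a time: reflecting coordinate \<open>b\<close> shows that its cross terms with the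
  other coordinates vanish.
\<close>

lemma nn_integral_std_gauss_inner_sq:
  fixes v :: "'a::euclidean_space"
  shows "(\<integral>\<^sup>+z. ennreal ((z \<bullet> v)\<^sup>2) \<partial>std_gauss) = ennreal ((norm v)\<^sup>2)"
proof -
  have basis: "(\<integral>\<^sup>+z. ennreal ((z \<bullet> b)\<^sup>2) \<partial>std_gauss) = 1" if b: "b \<in> Basis" for b :: 'a
  proof -
    let ?f = "\<lambda>c x. ennreal (if c = b then x\<^sup>2 * std_normal_density x else std_normal_density x)"
    have "(\<integral>\<^sup>+z. ennreal ((z \<bullet> b)\<^sup>2) \<partial>std_gauss) = (\<integral>\<^sup>+z. (\<Prod>c\<in>Basis. ?f c (z \<bullet> c)) \<partial>lborel)"
      unfolding std_gauss_def
    proof (subst nn_integral_density; (intro nn_integral_cong)?)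
      fix z :: 'a
      have "(\<Prod>c\<in>Basis - {b}. ?f c (z \<bullet> c)) = (\<Prod>c\<in>Basis - {b}. ennreal (std_normal_density (z \<bullet> c)))"
        by (intro prod.cong) auto
      then show "ennreal (\<Prod>c\<in>Basis. std_normal_density (z \<bullet> c)) * ennreal ((z \<bullet> b)\<^sup>2) = (\<Prod>c\<in>Basis. ?f c (z \<bullet> c))"
        using b by (simp add: prod.remove[of Basis b] prod_ennreal prod_nonneg ac_simps flip: ennreal_mult)
    qed auto
    also have "\<dots> = (\<Prod>c\<in>Basis. (\<integral>\<^sup>+x. ?f c x \<partial>lborel))"
      by (rule nn_integral_lborel_prod) auto
    also have "\<dots> = (\<Prod>c\<in>(Basis::'a set). 1)"
    proof (intro prod.cong refl)
      show "(\<integral>\<^sup>+x. ?f c x \<partial>lborel) = 1" for c :: 'a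
        by (cases "c = b") (simp_all add: nn_integral_std_normal_density nn_integral_sq_std_normal_density)
    qed
    finally show ?thesis by simp
  qed
  have "(\<integral>\<^sup>+z. ennreal ((z \<bullet> (\<Sum>b\<in>B. (v \<bullet> b) *\<^sub>R b))\<^sup>2) \<partial>std_gauss) = ennreal (\<Sum>b\<in>B. (v \<bullet> b)\<^sup>2)"
    if "finite B" "B \<subseteq> Basis" for B
    using that
  proof (induction B rule: finite_induct)
    case (insert b B)
    let ?s = "\<Sum>c\<in>B. (v \<bullet> c) *\<^sub>R c"
    have b: "b \<in> Basis" using insert by auto
    have sb: "b \<bullet> ?s = 0"
      using insert b by (auto simp: inner_sum_right inner_Basis intro!: sum.neutral)
    have "(\<integral>\<^sup>+z. ennreal ((z \<bullet> (\<Sum>b\<in>insert b B. (v \<bullet> b) *\<^sub>R b))\<^sup>2) \<partial>std_gauss)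
      = (\<integral>\<^sup>+z. ennreal ((norm ((v \<bullet> b) * (z \<bullet> b) + z \<bullet> ?s))\<^sup>2) \<partial>std_gauss)"
      using insert by (simp add: inner_simps power2_norm_eq_inner power2_eq_square)
    also have "\<dots> = (\<integral>\<^sup>+z. ennreal ((norm ((v \<bullet> b) * (z \<bullet> b)))\<^sup>2) \<partial>std_gauss) + (\<integral>\<^sup>+z. ennreal ((norm (z \<bullet> ?s))\<^sup>2) \<partial>std_gauss)"
      using b sb by (intro nn_integral_norm_sq_add_odd_even[where R="\<lambda>z. z - (2 * (z \<bullet> b)) *\<^sub>R b"]
          orthogonal_transformation_reflect) (auto simp: inner_diff_left right_diff_distrib)
    also have "(\<integral>\<^sup>+z. ennreal ((norm ((v \<bullet> b) * (z \<bullet> b)))\<^sup>2) \<partial>std_gauss) = ennreal ((v \<bullet> b)\<^sup>2)"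
      using b by (simp add: power_mult_distrib ennreal_mult nn_integral_cmult basis)
    finally show ?case
      using insert by (simp add: sum_nonneg)
  qed simp
  from this[OF finite_Basis subset_refl]
  have "(\<integral>\<^sup>+z. ennreal ((z \<bullet> v)\<^sup>2) \<partial>std_gauss) = ennreal (\<Sum>b\<in>Basis. (v \<bullet> b)\<^sup>2)"
    by (simp only: euclidean_representation)
  also have "(\<Sum>b\<in>Basis. (v \<bullet> b)\<^sup>2) = (norm v)\<^sup>2"
    unfolding power2_norm_eq_inner unfolding power2_eq_square by (rule euclidean_inner[symmetric])
  finally show ?thesis .
qed

text \<open>
  Coordinate \<open>i\<close> of the vector is the inner product of \<open>v\<close> with the pair of \<open>i\<close>-th rows of \<open>P\<close> and \<open>Q\<close>, so the
  integral is the squared Frobenius norm of the block matrix \<open>(P Q)\<close>.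
\<close>

lemma nn_integral_std_gauss_linear:
  fixes P :: "real^'n^'k" and Q :: "real^'m^'k"
  shows "(\<integral>\<^sup>+v. ennreal ((norm (P *v fst v + Q *v snd v))\<^sup>2) \<partial>std_gauss)
       = ennreal (trace (P ** transpose P + Q ** transpose Q))"
proof -
  have "ennreal ((norm (P *v fst v + Q *v snd v))\<^sup>2) = (\<Sum>i\<in>UNIV. ennreal ((v \<bullet> (row i P, row i Q))\<^sup>2))" for v
  proof -
    have "(P *v fst v + Q *v snd v) $ i = v \<bullet> (row i P, row i Q)" for i
      by (cases v) (simp add: matrix_vector_mult_def row_def inner_vec_def inner_Pair mult.commute)
    then show ?thesis
      by (simp add: norm_vec_def L2_set_def sum_nonneg sum_ennreal)
  qed
  then have "(\<integral>\<^sup>+v. ennreal ((norm (P *v fst v + Q *v snd v))\<^sup>2) \<partial>std_gauss)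
      = (\<Sum>i\<in>UNIV. ennreal ((norm (row i P, row i Q))\<^sup>2))"
    by (simp add: nn_integral_sum nn_integral_std_gauss_inner_sq del: sum_ennreal)
  also have "\<dots> = ennreal (trace (P ** transpose P + Q ** transpose Q))"
    by (simp add: sum_ennreal norm_Pair trace_def sum_nonneg matrix_matrix_mult_def transpose_def
         power2_norm_eq_inner inner_vec_def row_def del: ennreal_plus)
  finally show ?thesis .
qed

section \<open>Linear images of the standard Gaussian measure\<close>

text \<open>
  \<open>J = T\<^sup>* S\<^sup>-\<^sup>T\<close> embeds \<open>real^'m\<close> isometrically into the orthogonal complement of the kernel of \<open>T\<close>. The
  orthogonal complement \<open>W\<close> of its range has the dimension of \<open>'a\<close>, so an isometry of \<open>'a\<close> onto \<open>W\<close> completes \<open>J\<close>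
  to a rotation of the whole space after which \<open>T\<close> sees only the second coordinate. The last
  conclusion says that the second coordinate axis is mapped into the range of \<open>T\<^sup>*\<close>; it shows that linear
  maps vanishing on this range, i.e. uncorrelated with \<open>T\<close>, depend on the first coordinate only.
\<close>

lemma rotation_onto_last_coordinates:
  fixes T :: "'a::euclidean_space \<times> (real^'m) \<Rightarrow> real^'m" and S :: "real^'m^'m"
  assumes T: "linear T" and TT: "\<And>y. T (adjoint T y) = (S ** transpose S) *v y" and S: "invertible S"
  obtains R :: "'a \<times> (real^'m) \<Rightarrow> 'a \<times> (real^'m)"
    where "orthogonal_transformation R" "\<And>a b. T (R (a, b)) = S *v b"
    "\<And>b. \<exists>y. R (0, b) = adjoint T y"
proof -
  define J where "J = (\<lambda>b. adjoint T (transpose (matrix_inv S) *v b))"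
  have inv: "transpose S ** transpose (matrix_inv S) = mat 1"
    using matrix_inv_mult(2)[OF S] by (metis matrix_transpose_mul transpose_mat)
  have inv': "transpose (matrix_inv S) ** transpose S = mat 1"
    using matrix_inv_mult(1)[OF S] by (metis matrix_transpose_mul transpose_mat)
  have adj: "x \<bullet> adjoint T y = T x \<bullet> y" for x y by (rule adjoint_works[OF T])
  have linJ: "linear J"
    unfolding J_def by (rule linear_compose[OF matrix_vector_mul_linear adjoint_linear[OF T], unfolded comp_def])
  have TJ: "T (J b) = S *v b" for b
    by (simp only: J_def TT matrix_vector_mul_assoc matrix_mul_assoc[symmetric] inv matrix_mul_rid)
  \<comment> \<open>\<open>J\<^sup>* J = S\<^sup>-\<^sup>1 T T\<^sup>* S\<^sup>-\<^sup>T = 1\<close>\<close>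
  have JJ: "J b \<bullet> J c = b \<bullet> c" for b c
  proof -
    have "J b \<bullet> J c = T (J b) \<bullet> (transpose (matrix_inv S) *v c)" unfolding J_def by (rule adj)
    also have "\<dots> = b \<bullet> (transpose S *v (transpose (matrix_inv S) *v c))"
      unfolding TJ by (rule inner_matrix_vector_mult)
    finally show ?thesis by (simp only: matrix_vector_mul_assoc inv matrix_vector_mul_lid)
  qed
  have injJ: "inj J"
    unfolding linear_injective_0[OF linJ] by (metis JJ inner_eq_zero_iff)
  have adjJ: "adjoint T y = J (transpose S *v y)" for y
    by (simp only: J_def matrix_vector_mul_assoc inv' matrix_vector_mul_lid)
  define W where "W = {v. \<forall>x\<in>range J. orthogonal x v}"
  have "dim {v \<in> UNIV. \<forall>x\<in>range J. orthogonal x v} + dim (range J) = dim (UNIV :: ('a \<times> (real^'m)) set)"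
    by (rule dim_subspace_orthogonal_to_vectors) (auto intro: linear_subspace_image linJ)
  moreover have "dim (range J) = DIM(real^'m)"
    using dim_image_eq[OF linJ, of UNIV] injJ by simp
  ultimately have dimW: "dim (UNIV :: 'a set) = dim W" by (simp add: W_def)
  have "subspace W" unfolding W_def by (rule subspace_orthogonal_to_vectors)
  then obtain f g where f: "linear (f :: 'a \<Rightarrow> _)" "f ` UNIV = W" "\<And>x. norm (f x) = norm x"
    using isometries_subspaces[OF subspace_UNIV _ dimW] by (metis UNIV_I)
  have fJ: "f a \<bullet> J b = 0" for a b
  proof -
    have "f a \<in> W" using f(2) by blast
    then show ?thesis by (simp add: W_def orthogonal_def inner_commute)
  qed
  have Tf: "T (f a) = 0" for a
  proof -
    have "T (f a) \<bullet> y = 0" for y using fJ by (simp flip: adj add: adjJ)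
    then show ?thesis by (metis inner_eq_zero_iff)
  qed
  define R where "R = (\<lambda>(a, b). f a + J b)"
  have R: "orthogonal_transformation R"
  proof -
    have "linear R"
      by (rule linearI)
         (simp_all add: R_def split_beta linear_add[OF f(1)] linear_add[OF linJ] linear_scale[OF f(1)]
           linear_scale[OF linJ] scaleR_add_right)
    moreover have "norm (R v) = norm v" for v
    proof -
      obtain a b where v: "v = (a, b)" by (cases v)
      have "R v \<bullet> R v = f a \<bullet> f a + J b \<bullet> J b"
        using fJ[of a b] by (simp add: v R_def inner_add_left inner_add_right inner_commute[of "J b" "f a"])
      also have "\<dots> = v \<bullet> v"
        using f(3)[of a] by (simp add: v JJ norm_eq)
      finally show ?thesis by (simp add: norm_eq)
    qed
    ultimately show ?thesis by (simp add: orthogonal_transformation)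
  qed
  have TR: "T (R (a, b)) = S *v b" for a b by (simp add: R_def linear_add[OF T] Tf TJ)
  have R0: "\<exists>y. R (0, b) = adjoint T y" for b
    by (rule exI[of _ "transpose (matrix_inv S) *v b"]) (simp add: R_def linear_0[OF f(1)] J_def)
  show thesis by (rule that[OF R TR R0])
qed

lemma borel_measurable_gaussian_density [measurable]: "gaussian_density u C \<in> borel_measurable borel"
  unfolding gaussian_density_def[abs_def] by measurable

lemma gaussian_density_nonneg:
  fixes C :: "real^'n^'n"
  assumes "pos_semidef C"
  shows "0 \<le> gaussian_density u C z"
proof -
  obtain A :: "real^'n^'n" where "A ** transpose A = C" by (rule pos_semidef_factor[OF assms])
  then have "det C = (det A)\<^sup>2" by (auto simp: det_mul power2_eq_square)
  then show ?thesis by (simp add: gaussian_density_def)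
qed

text \<open>
  The change of variables \<open>y = u + S z\<close> at the level of densities: \<open>(S S\<^sup>T)\<^sup>-\<^sup>1 = S\<^sup>-\<^sup>T S\<^sup>-\<^sup>1\<close> turns the
  quadratic form at \<open>S z\<close> into \<open>\<parallel>z\<parallel>\<^sup>2\<close>, and the Jacobian is the square root of the determinant of the
  covariance.
\<close>

lemma gaussian_density_linear_image:
  fixes S :: "real^'m^'m"
  assumes S: "invertible S"
  shows "(\<Prod>b\<in>Basis. std_normal_density (z \<bullet> b)) = \<bar>det S\<bar> * gaussian_density u (S ** transpose S) (u + S *v z)"
proof -
  let ?I = "matrix_inv S"
  have inv: "matrix_inv (S ** transpose S) = transpose ?I ** ?I"
  proof (rule matrix_inv_eq)
    have "transpose S ** transpose ?I = mat 1"
      using matrix_inv_mult(2)[OF S] by (metis matrix_transpose_mul transpose_mat)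
    then show "S ** transpose S ** (transpose ?I ** ?I) = mat 1"
      using matrix_inv_mult(1)[OF S] by (simp add: matrix_mul_assoc) (simp add: matrix_mul_assoc[symmetric])
  qed
  have IS: "?I *v (S *v z) = z"
    by (simp only: matrix_vector_mul_assoc matrix_inv_mult(2)[OF S] matrix_vector_mul_lid)
  have "(S *v z) \<bullet> (transpose ?I ** ?I *v (S *v z)) = (S *v z) \<bullet> (transpose ?I *v (?I *v (S *v z)))"
    by (simp only: matrix_vector_mul_assoc matrix_mul_assoc)
  also have "\<dots> = (norm z)\<^sup>2"
    by (simp only: inner_matrix_vector_mult[symmetric] IS power2_norm_eq_inner)
  finally have q: "(S *v z) \<bullet> (transpose ?I ** ?I *v (S *v z)) = (norm z)\<^sup>2" .
  have d: "det (S ** transpose S) = (det S)\<^sup>2" "det S \<noteq> 0"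
    using S by (auto simp: det_mul power2_eq_square invertible_det_nz)
  show ?thesis
    unfolding std_gauss_density_eq gaussian_density_def
    using d(2) by (simp add: inv q d(1) real_sqrt_mult)
qed

text \<open>
  \<open>u + T v\<close> has the Gaussian law with mean \<open>u\<close> and covariance \<open>C = T T\<^sup>*\<close>. After a rotation \<open>T\<close> becomes an
  invertible map \<open>S\<close> of the last coordinates; the other coordinates integrate to 1.
\<close>

lemma nn_integral_gaussian_image:
  fixes T :: "'a::euclidean_space \<times> (real^'m) \<Rightarrow> real^'m" and C :: "real^'m^'m"
  assumes T: "linear T" and TT: "\<And>y. T (adjoint T y) = C *v y" and C: "pos_semidef C" "invertible C"
    and [measurable]: "g \<in> borel_measurable borel"
  shows "(\<integral>\<^sup>+v. g (u + T v) \<partial>std_gauss) = (\<integral>\<^sup>+y. ennreal (gaussian_density u C y) * g y \<partial>lborel)"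
proof -
  obtain S :: "real^'m^'m" where S: "S ** transpose S = C" by (rule pos_semidef_factor[OF C(1)])
  then have invS: "invertible S"
    using C(2) by (auto simp: invertible_det_nz det_mul)
  then have det: "det S \<noteq> 0" by (simp add: invertible_det_nz)
  obtain R :: "'a \<times> (real^'m) \<Rightarrow> 'a \<times> (real^'m)"
    where R: "orthogonal_transformation R" "\<And>a b. T (R (a, b)) = S *v b"
    by (rule rotation_onto_last_coordinates[OF T TT[folded S] invS]) (rule that)
  have [measurable]: "T \<in> borel_measurable borel" by (rule borel_measurable_linear) fact
  have [measurable]: "R \<in> borel_measurable borel"
    by (rule borel_measurable_linear) (use R in \<open>simp add: orthogonal_transformation\<close>)
  let ?d = "\<lambda>y. ennreal (gaussian_density u C y) * g y"
  have "(\<integral>\<^sup>+v. g (u + T v) \<partial>std_gauss) = (\<integral>\<^sup>+v. g (u + T (R v)) \<partial>std_gauss)"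
    by (rule nn_integral_std_gauss_orthogonal[OF R(1), symmetric]) measurable
  also have "\<dots> = (\<integral>\<^sup>+a. \<integral>\<^sup>+b. g (u + S *v b) \<partial>std_gauss \<partial>(std_gauss :: 'a measure))"
    by (subst nn_integral_std_gauss_pair(1)) (simp_all add: R(2))
  also have "\<dots> = (\<integral>\<^sup>+b. g (u + S *v b) \<partial>std_gauss)"
    by (simp add: std_gauss.emeasure_space_1[simplified])
  also have "\<dots> = (\<integral>\<^sup>+b. ennreal \<bar>det S\<bar> * ?d (u + S *v b) \<partial>lborel)"
    unfolding std_gauss_def
    by (subst nn_integral_density)
       (simp_all only: gaussian_density_linear_image[OF invS, of _ u] S ennreal_mult'[OF abs_ge_zero] mult.assoc, measurable)
  also have "\<dots> = ennreal \<bar>det S\<bar> * (\<integral>\<^sup>+b. ?d (u + S *v b) \<partial>lborel)"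
    by (rule nn_integral_cmult) measurable
  also have "(\<integral>\<^sup>+b. ?d (u + S *v b) \<partial>lborel) = ennreal (1 / \<bar>det S\<bar>) * (\<integral>\<^sup>+y. ?d (u + y) \<partial>lborel)"
    using matrix_scales_volume[OF det] unfolding scales_volume_def
    by (elim conjE) (rule bspec[where x="\<lambda>y. ?d (u + y)"], assumption, measurable)
  also have "(\<integral>\<^sup>+y. ?d (u + y) \<partial>lborel) = (\<integral>\<^sup>+y. ?d y \<partial>distr lborel borel ((+) u))"
    by (simp add: nn_integral_distr)
  also have "\<dots> = (\<integral>\<^sup>+y. ?d y \<partial>lborel)" by (simp only: lborel_distr_plus)
  also have "ennreal \<bar>det S\<bar> * (ennreal (1 / \<bar>det S\<bar>) * (\<integral>\<^sup>+y. ?d y \<partial>lborel)) = (\<integral>\<^sup>+y. ?d y \<partial>lborel)"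
    using det by (simp add: mult.assoc[symmetric] ennreal_mult[symmetric])
  finally show ?thesis .
qed

section \<open>A pair of independent Gaussian vectors\<close>

lemma linear_pair_matrix:
  fixes P :: "real^'n^'m" and B :: "real^'k^'m"
  shows "linear (\<lambda>v. P *v fst v + B *v snd v)"
  by (rule linearI) (simp_all add: matrix_vector_right_distrib matrix_vector_mult_scaleR scaleR_add_right)

lemma adjoint_pair_matrix:
  fixes P :: "real^'n^'m" and B :: "real^'k^'m"
  shows "adjoint (\<lambda>v. P *v fst v + B *v snd v) y = (transpose P *v y, transpose B *v y)"
proof -
  have "adjoint (\<lambda>v. P *v fst v + B *v snd v) = (\<lambda>y. (transpose P *v y, transpose B *v y))"
    by (rule adjoint_unique) (auto simp: inner_add_left inner_matrix_vector_mult simp del: vector_transpose_matrix)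
  then show ?thesis by simp
qed

text \<open>
  \<open>T T\<^sup>*\<close> is the covariance of \<open>H A z + B z'\<close>.
\<close>

lemma pair_matrix_adjoint:
  fixes H :: "real^'n^'m" and A :: "real^'n^'n" and B :: "real^'m^'m"
  assumes A: "A ** transpose A = Cx" and B: "B ** transpose B = Cn"
  defines "T \<equiv> \<lambda>v. (H ** A) *v fst v + B *v snd v"
  shows "T (adjoint T y) = (H ** Cx ** transpose H + Cn) *v y"
proof -
  have HA: "(H ** A) ** transpose (H ** A) = H ** Cx ** transpose H"
    by (simp only: matrix_transpose_mul matrix_mul_assoc A[symmetric])
  have adj: "adjoint T y = (transpose (H ** A) *v y, transpose B *v y)"
    unfolding T_def by (rule adjoint_pair_matrix)
  have "T (adjoint T y) = ((H ** A) ** transpose (H ** A)) *v y + (B ** transpose B) *v y"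
    by (subst adj) (simp only: T_def fst_conv snd_conv matrix_vector_mul_assoc)
  then show ?thesis by (simp only: HA B matrix_vector_mult_add_rdistrib)
qed

lemma component_output_density:
  fixes H :: "real^'n^'m" and A :: "real^'n^'n" and B :: "real^'m^'m"
  assumes A: "A ** transpose A = Cx" and B: "B ** transpose B = Cn"
    and psd: "pos_semidef Cx" "pos_semidef Cn"
    and inv: "invertible (H ** Cx ** transpose H + Cn)"
    and g: "g \<in> borel_measurable borel"
  shows "(\<integral>\<^sup>+v. g (H *v (ux + A *v fst v) + (un + B *v snd v)) \<partial>std_gauss)
     = (\<integral>\<^sup>+y. ennreal (gaussian_density (H *v ux + un) (H ** Cx ** transpose H + Cn) y) * g y \<partial>lborel)"
proof -
  have eq: "H *v (ux + A *v fst v) + (un + B *v snd v) = (H *v ux + un) + ((H ** A) *v fst v + B *v snd v)" for v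
    by (simp add: matrix_vector_right_distrib matrix_vector_mul_assoc)
  show ?thesis
    unfolding eq by (rule nn_integral_gaussian_image[OF linear_pair_matrix pair_matrix_adjoint[OF A B]
        pos_semidef_congruence_add[OF psd] inv g])
qed

text \<open>
  The error splits into the residual \<open>F\<close> of the linear estimator, plus a function \<open>D\<close> of the output \<open>T\<close> alone.
  The choice of the gain \<open>V\<close> makes \<open>F T\<^sup>* = 0\<close>, so after the rotation that straightens \<open>T\<close> the residual depends
  on the first coordinate only. The reflection \<open>\<rho>\<close> of that coordinate then negates the residual and preserves
  the output, and the two squared norms add up.
\<close>

lemma component_error_decomposition:
  fixes H :: "real^'n^'m" and A :: "real^'n^'n" and B :: "real^'m^'m"
    and ux :: "real^'n" and un :: "real^'m" and h :: "real^'m \<Rightarrow> real^'n"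
  assumes A: "A ** transpose A = Cx" and B: "B ** transpose B = Cn"
    and psd: "pos_semidef Cx" "pos_semidef Cn"
    and inv: "invertible (H ** Cx ** transpose H + Cn)"
    and h[measurable]: "h \<in> borel_measurable borel"
  defines "C \<equiv> H ** Cx ** transpose H + Cn"
  defines "V \<equiv> Cx ** transpose H ** matrix_inv C"
  defines "X \<equiv> \<lambda>v. ux + A *v fst v" and "W \<equiv> \<lambda>v. un + B *v snd v"
  shows "(\<integral>\<^sup>+v. ennreal ((norm (X v - h (H *v X v + W v)))\<^sup>2) \<partial>std_gauss)
     = ennreal (trace (Cx - V ** H ** Cx))
       + (\<integral>\<^sup>+y. ennreal (gaussian_density (H *v ux + un) C y)
             * ennreal ((norm (ux + V *v (y - (H *v ux + un)) - h y))\<^sup>2) \<partial>lborel)"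
proof -
  define T where "T = (\<lambda>v::(real^'n) \<times> (real^'m). (H ** A) *v fst v + B *v snd v)"
  define F where "F = (\<lambda>v::(real^'n) \<times> (real^'m). A *v fst v - V *v T v)"
  let ?uy = "H *v ux + un"
  let ?D = "\<lambda>y. ux + V *v y - h (?uy + y)"
  have psdC: "pos_semidef C" unfolding C_def by (rule pos_semidef_congruence_add[OF psd])
  have T: "linear T" unfolding T_def by (rule linear_pair_matrix)
  have F: "linear F"
    by (rule linearI)
       (simp_all add: F_def linear_add[OF T] linear_scale[OF T] matrix_vector_right_distrib matrix_vector_mult_scaleR scaleR_diff_right)
  have [measurable]: "T \<in> borel_measurable borel" "F \<in> borel_measurable borel"
    using T F by (simp_all add: borel_measurable_linear)
  have adj: "adjoint T y = (transpose (H ** A) *v y, transpose B *v y)" for y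
    unfolding T_def by (rule adjoint_pair_matrix)
  have TT: "T (adjoint T y) = C *v y" for y
    unfolding T_def C_def by (rule pair_matrix_adjoint[OF A B])
  have VC: "V ** C = Cx ** transpose H"
    unfolding V_def matrix_mul_assoc[symmetric] by (simp add: matrix_inv_mult(2) inv C_def)
  \<comment> \<open>The residual and the output are uncorrelated.\<close>
  have FT: "F (adjoint T y) = 0" for y
  proof -
    have "A *v fst (adjoint T y) = (A ** transpose A ** transpose H) *v y"
      by (simp only: adj fst_conv matrix_vector_mul_assoc matrix_transpose_mul matrix_mul_assoc)
    moreover have "V *v T (adjoint T y) = (V ** C) *v y"
      by (simp only: TT matrix_vector_mul_assoc)
    ultimately show ?thesis by (simp only: F_def A VC diff_self)
  qed
  obtain S :: "real^'m^'m" where S: "S ** transpose S = C" by (rule pos_semidef_factor[OF psdC])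
  have invS: "invertible S"
    using inv unfolding invertible_det_nz C_def[symmetric] S[symmetric] det_mul by simp
  obtain R :: "(real^'n) \<times> (real^'m) \<Rightarrow> (real^'n) \<times> (real^'m)"
    where R: "orthogonal_transformation R" and TR: "\<And>a b. T (R (a, b)) = S *v b"
      and R0: "\<And>b. \<exists>y. R (0, b) = adjoint T y"
    by (rule rotation_onto_last_coordinates[OF T TT[folded S] invS]) (rule that)
  have linR: "linear R" using R by (simp add: orthogonal_transformation)
  have [measurable]: "R \<in> borel_measurable borel" by (rule borel_measurable_linear[OF linR])
  have FR: "F (R (a, b)) = F (R (a, 0))" for a b
  proof -
    have "F (R (a, b)) = F (R (a, 0)) + F (R (0, b))"
      using linear_add[OF linear_compose[OF linR F], of "(a, 0)" "(0, b)"] by simp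
    then show ?thesis using R0[of b] FT by auto
  qed
  have FRneg: "F (R (- a, b)) = - F (R (a, b))" for a b
    unfolding FR[of _ b] using linear_neg[OF linear_compose[OF linR F], of "(a, 0)"] by simp
  define \<rho> where "\<rho> = (\<lambda>v::(real^'n) \<times> (real^'m). (- fst v, snd v))"
  have \<rho>: "orthogonal_transformation \<rho>"
    unfolding orthogonal_transformation
    by (auto intro!: linearI simp: \<rho>_def norm_Pair norm_prod_def)
  have split: "X v - h (H *v X v + W v) = F v + ?D (T v)" for v
    by (simp add: X_def W_def F_def T_def matrix_vector_right_distrib matrix_vector_mul_assoc algebra_simps)
  have "(\<integral>\<^sup>+v. ennreal ((norm (X v - h (H *v X v + W v)))\<^sup>2) \<partial>std_gauss)
      = (\<integral>\<^sup>+v. ennreal ((norm (F (R v) + ?D (T (R v))))\<^sup>2) \<partial>std_gauss)"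
    unfolding split by (rule nn_integral_std_gauss_orthogonal[OF R, symmetric]) measurable
  also have "\<dots> = (\<integral>\<^sup>+v. ennreal ((norm (F (R v)))\<^sup>2) \<partial>std_gauss) + (\<integral>\<^sup>+v. ennreal ((norm (?D (T (R v))))\<^sup>2) \<partial>std_gauss)"
    by (rule nn_integral_norm_sq_add_odd_even[OF \<rho>, where F="\<lambda>v. F (R v)" and D="\<lambda>v. ?D (T (R v))"])
       (auto simp: \<rho>_def FRneg TR split_paired_all simp flip: prod.collapse)
  also have "(\<integral>\<^sup>+v. ennreal ((norm (F (R v)))\<^sup>2) \<partial>std_gauss) = (\<integral>\<^sup>+v. ennreal ((norm (F v))\<^sup>2) \<partial>std_gauss)"
    by (rule nn_integral_std_gauss_orthogonal[OF R]) measurable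
  also have "\<dots> = ennreal (trace (Cx - V ** H ** Cx))"
  proof -
    \<comment> \<open>The residual is \<open>(1 - V H) A z - V B z'\<close>.\<close>
    let ?P = "(mat 1 - V ** H) ** A" and ?Q = "- (V ** B)"
    have "F v = ?P *v fst v + ?Q *v snd v" for v
      by (simp add: F_def T_def matrix_vector_right_distrib matrix_diff_rdistrib matrix_vector_mul_assoc
         matrix_vector_mult_diff_rdistrib matrix_mul_assoc matrix_vector_mult_uminus)
    then have "(\<integral>\<^sup>+v. ennreal ((norm (F v))\<^sup>2) \<partial>std_gauss) = ennreal (trace (?P ** transpose ?P + ?Q ** transpose ?Q))"
      by (simp only: nn_integral_std_gauss_linear)
    also have "?P ** transpose ?P = (mat 1 - V ** H) ** Cx ** transpose (mat 1 - V ** H)"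
      by (simp only: matrix_transpose_mul matrix_mul_assoc A[symmetric])
    also have "?Q ** transpose ?Q = V ** Cn ** transpose V"
    proof -
      have "?Q ** transpose ?Q = (V ** B) ** transpose (V ** B)"
        by (simp add: matrix_matrix_mult_def transpose_def vec_eq_iff)
      then show ?thesis by (simp only: matrix_transpose_mul matrix_mul_assoc B[symmetric])
    qed
    also have "(mat 1 - V ** H) ** Cx ** transpose (mat 1 - V ** H) + V ** Cn ** transpose V = Cx - V ** H ** Cx"
      unfolding V_def C_def by (rule linear_estimator_error_covariance[OF inv])
    finally show ?thesis .
  qed
  also have "(\<integral>\<^sup>+v. ennreal ((norm (?D (T (R v))))\<^sup>2) \<partial>std_gauss) = (\<integral>\<^sup>+v. ennreal ((norm (?D (T v)))\<^sup>2) \<partial>std_gauss)"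
    by (rule nn_integral_std_gauss_orthogonal[OF R]) measurable
  also have "\<dots> = (\<integral>\<^sup>+v. ennreal ((norm (ux + V *v ((H *v X v + W v) - ?uy) - h (H *v X v + W v)))\<^sup>2) \<partial>std_gauss)"
    by (simp add: X_def W_def T_def matrix_vector_right_distrib matrix_vector_mul_assoc algebra_simps)
  also have "\<dots> = (\<integral>\<^sup>+y. ennreal (gaussian_density ?uy C y) * ennreal ((norm (ux + V *v (y - ?uy) - h y))\<^sup>2) \<partial>lborel)"
    unfolding X_def W_def C_def
    by (rule component_output_density[OF A B psd inv, where g="\<lambda>y. ennreal ((norm (ux + V *v (y - ?uy) - h y))\<^sup>2)"]) measurable
  finally show ?thesis .
qed

text \<open>
  Bias-variance decomposition: the centred part is odd under \<open>v \<mapsto> - v\<close>, the bias is constant.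
\<close>

lemma component_affine_error:
  fixes P :: "real^'n^'k" and Q :: "real^'m^'k" and A :: "real^'n^'n" and B :: "real^'m^'m"
  assumes A: "A ** transpose A = Cx" and B: "B ** transpose B = Cn"
    and psd: "pos_semidef Cx" "pos_semidef Cn"
  shows "(\<integral>\<^sup>+v. ennreal ((norm (P *v (ux + A *v fst v) + Q *v (un + B *v snd v) - c))\<^sup>2) \<partial>std_gauss)
    = ennreal (trace (P ** Cx ** transpose P) + trace (Q ** Cn ** transpose Q) + (norm (P *v ux + Q *v un - c))\<^sup>2)"
proof -
  let ?F = "\<lambda>v. (P ** A) *v fst v + (Q ** B) *v snd v" and ?d = "P *v ux + Q *v un - c"
  have F: "linear ?F" by (rule linear_pair_matrix)
  have [measurable]: "?F \<in> borel_measurable borel" by (rule borel_measurable_linear[OF F])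
  have eq: "P *v (ux + A *v fst v) + Q *v (un + B *v snd v) - c = ?F v + ?d" for v
    by (simp add: matrix_vector_right_distrib matrix_vector_mul_assoc)
  have "(\<integral>\<^sup>+v. ennreal ((norm (P *v (ux + A *v fst v) + Q *v (un + B *v snd v) - c))\<^sup>2) \<partial>std_gauss)
     = (\<integral>\<^sup>+v. ennreal ((norm (?F v + ?d))\<^sup>2) \<partial>std_gauss)"
    by (simp only: eq)
  also have "\<dots> = (\<integral>\<^sup>+v. ennreal ((norm (?F v))\<^sup>2) \<partial>std_gauss) + (\<integral>\<^sup>+v. ennreal ((norm ?d)\<^sup>2) \<partial>(std_gauss :: ((real^'n) \<times> (real^'m)) measure))"
    by (rule nn_integral_norm_sq_add_odd_even[OF orthogonal_transformation_uminus]) (simp_all only: linear_neg[OF F], measurable)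
  also have "(\<integral>\<^sup>+v. ennreal ((norm ?d)\<^sup>2) \<partial>(std_gauss :: ((real^'n) \<times> (real^'m)) measure)) = ennreal ((norm ?d)\<^sup>2)"
    by (simp add: std_gauss.emeasure_space_1[simplified])
  also have "(\<integral>\<^sup>+v. ennreal ((norm (?F v))\<^sup>2) \<partial>std_gauss)
     = ennreal (trace ((P ** A) ** transpose (P ** A) + (Q ** B) ** transpose (Q ** B)))"
    by (rule nn_integral_std_gauss_linear)
  also have "trace ((P ** A) ** transpose (P ** A) + (Q ** B) ** transpose (Q ** B))
     = trace (P ** Cx ** transpose P) + trace (Q ** Cn ** transpose Q)"
    by (simp only: matrix_transpose_mul matrix_mul_assoc A[symmetric] B[symmetric] trace_add)
  also have "ennreal (trace (P ** Cx ** transpose P) + trace (Q ** Cn ** transpose Q)) + ennreal ((norm ?d)\<^sup>2)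
    = ennreal (trace (P ** Cx ** transpose P) + trace (Q ** Cn ** transpose Q) + (norm ?d)\<^sup>2)"
    by (intro ennreal_plus[symmetric] add_nonneg_nonneg trace_congruence_nonneg psd) simp
  finally show ?thesis .
qed

section \<open>Laws of Gaussian mixtures\<close>

text \<open>
  The factor of the covariance through which \<open>gaussian_measure\<close> is defined.
\<close>

definition gauss_factor :: "real^'n^'n \<Rightarrow> real^'n^'n" where
  "gauss_factor C = (SOME A. A ** transpose A = C)"

lemma gauss_factor: "pos_semidef C \<Longrightarrow> gauss_factor C ** transpose (gauss_factor C) = C"
  unfolding gauss_factor_def by (rule pos_semidef_factor) (auto intro: someI)

lemma nn_integral_gaussian_measure:
  assumes [measurable]: "g \<in> borel_measurable borel"
  shows "(\<integral>\<^sup>+x. g x \<partial>gaussian_measure u C) = (\<integral>\<^sup>+z. g (u + gauss_factor C *v z) \<partial>std_gauss)"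
  unfolding gaussian_measure_def std_gaussian_measure_eq gauss_factor_def[symmetric]
  by (subst nn_integral_distr) simp_all

lemma sets_gaussian_measure [simp, measurable_cong]: "sets (gaussian_measure u C) = sets borel"
  by (simp add: gaussian_measure_def)

lemma prob_space_gaussian_measure: "prob_space (gaussian_measure u C)"
  unfolding gaussian_measure_def std_gaussian_measure_eq
  by (rule std_gauss.prob_space_distr) simp

text \<open>
  A convex combination of measures is the law of a two-stage experiment, so integrals are given by the formula
  for the monadic bind over the index set.
\<close>

lemma nn_integral_finite_mixture:
  assumes K: "finite K" "K \<noteq> {}" and p: "\<And>k. k \<in> K \<Longrightarrow> 0 \<le> p k"
    and N: "sets N = sets B"
    and P: "\<And>k. k \<in> K \<Longrightarrow> prob_space (P k)" "\<And>k. k \<in> K \<Longrightarrow> sets (P k) = sets B"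
    and mix: "\<And>A. A \<in> sets B \<Longrightarrow> emeasure N A = (\<Sum>k\<in>K. ennreal (p k) * emeasure (P k) A)"
    and g[measurable]: "g \<in> borel_measurable B"
  shows "(\<integral>\<^sup>+x. g x \<partial>N) = (\<Sum>k\<in>K. ennreal (p k) * (\<integral>\<^sup>+x. g x \<partial>P k))"
proof -
  let ?Q = "point_measure K (\<lambda>k. ennreal (p k))"
  have Pm: "P \<in> ?Q \<rightarrow>\<^sub>M subprob_algebra B"
  proof -
    have "P \<in> count_space K \<rightarrow>\<^sub>M subprob_algebra B"
      using P by (auto simp: space_subprob_algebra intro: prob_space_imp_subprob_space)
    then show ?thesis by (simp add: measurable_def space_point_measure sets_point_measure)
  qed
  have "N = ?Q \<bind> P"
  proof (rule measure_eqI)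
    show "sets N = sets (?Q \<bind> P)"
      using N K P(2) sets_bind[of ?Q P B] by (simp add: space_point_measure)
    fix A assume "A \<in> sets N"
    then have [measurable]: "A \<in> sets B" using N by simp
    show "emeasure N A = emeasure (?Q \<bind> P) A"
      using K by (subst emeasure_bind[OF _ Pm]) (simp_all add: mix space_point_measure nn_integral_point_measure_finite)
  qed
  then show ?thesis
    using K by (simp add: nn_integral_bind[OF g Pm] nn_integral_point_measure_finite)
qed

lemma nn_integral_gaussian_mixture:
  assumes law: "has_gaussian_mixture_law M X K p u C" and M: "prob_space M"
    and K: "finite K" and p: "\<And>k. k \<in> K \<Longrightarrow> 0 \<le> p k" and sum: "(\<Sum>k\<in>K. p k) = 1"
    and g[measurable]: "g \<in> borel_measurable borel"
  shows "(\<integral>\<^sup>+x. g x \<partial>distr M borel X) = (\<Sum>k\<in>K. ennreal (p k) * (\<integral>\<^sup>+z. g (u k + gauss_factor (C k) *v z) \<partial>std_gauss))"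
proof -
  interpret M: prob_space M by fact
  have X[measurable]: "X \<in> borel_measurable M" using law by (simp add: has_gaussian_mixture_law_def)
  interpret D: prob_space "distr M borel X" by (rule M.prob_space_distr) fact
  have "K \<noteq> {}" using sum by auto
  have "(\<integral>\<^sup>+x. g x \<partial>distr M borel X) = (\<Sum>k\<in>K. ennreal (p k) * (\<integral>\<^sup>+x. g x \<partial>gaussian_measure (u k) (C k)))"
  proof (rule nn_integral_finite_mixture[OF K \<open>K \<noteq> {}\<close> p])
    fix A :: "(real^'b) set" assume "A \<in> sets borel"
    then have "measure (distr M borel X) A = (\<Sum>k\<in>K. p k * measure (gaussian_measure (u k) (C k)) A)"
      using law by (simp add: has_gaussian_mixture_law_def)
    moreover have "emeasure (gaussian_measure (u k) (C k)) A = ennreal (measure (gaussian_measure (u k) (C k)) A)" for k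
      using prob_space_gaussian_measure by (intro finite_measure.emeasure_eq_measure prob_space.finite_measure)
    ultimately show "emeasure (distr M borel X) A = (\<Sum>k\<in>K. ennreal (p k) * emeasure (gaussian_measure (u k) (C k)) A)"
      using p by (simp add: D.emeasure_eq_measure sum_ennreal flip: ennreal_mult)
  qed (auto intro: prob_space_gaussian_measure)
  then show ?thesis by (simp add: nn_integral_gaussian_measure)
qed

text \<open>
  By independence the joint law is the product of the two mixtures, that is, the mixture over all pairs of
  components of products of Gaussian laws. Each such product is the image of one standard Gaussian measure on
  pairs.
\<close>

lemma nn_integral_independent_mixtures:
  fixes x :: "'a \<Rightarrow> real^'n" and w :: "'a \<Rightarrow> real^'m"
  assumes M: "prob_space M"
    and K: "finite K" "\<And>k. k \<in> K \<Longrightarrow> 0 \<le> p k" "(\<Sum>k\<in>K. p k) = 1"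
    and L: "finite L" "\<And>l. l \<in> L \<Longrightarrow> 0 \<le> q l" "(\<Sum>l\<in>L. q l) = 1"
    and x: "has_gaussian_mixture_law M x K p ux Cx" and w: "has_gaussian_mixture_law M w L q un Cn"
    and indep: "prob_space.indep_set M (sets (vimage_algebra (space M) x borel)) (sets (vimage_algebra (space M) w borel))"
    and g'[measurable]: "(\<lambda>(a, b). g a b) \<in> borel_measurable (borel \<Otimes>\<^sub>M borel)"
  shows "(\<integral>\<^sup>+\<omega>. g (x \<omega>) (w \<omega>) \<partial>M) = (\<Sum>k\<in>K. \<Sum>l\<in>L. ennreal (p k * q l) *
    (\<integral>\<^sup>+v. g (ux k + gauss_factor (Cx k) *v fst v) (un l + gauss_factor (Cn l) *v snd v) \<partial>std_gauss))"
proof -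
  interpret M: prob_space M by fact
  have [measurable]: "x \<in> borel_measurable M" "w \<in> borel_measurable M"
    using x w by (simp_all add: has_gaussian_mixture_law_def)
  interpret X: prob_space "distr M borel x" by (rule M.prob_space_distr) measurable
  interpret W: prob_space "distr M borel w" by (rule M.prob_space_distr) measurable
  have eq: "distr M borel x \<Otimes>\<^sub>M distr M borel w = distr M (borel \<Otimes>\<^sub>M borel) (\<lambda>\<omega>. (x \<omega>, w \<omega>))"
  proof (rule pair_measure_eqI)
    fix A B assume "A \<in> sets (distr M borel x)" "B \<in> sets (distr M borel w)"
    then have [measurable]: "A \<in> sets borel" "B \<in> sets borel" by simp_all
    have "x -` A \<inter> space M \<in> sets (vimage_algebra (space M) x borel)"
      "w -` B \<inter> space M \<in> sets (vimage_algebra (space M) w borel)"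
      by (auto intro: in_vimage_algebra)
    then have "M.prob ((x -` A \<inter> space M) \<inter> (w -` B \<inter> space M)) = M.prob (x -` A \<inter> space M) * M.prob (w -` B \<inter> space M)"
      by (rule M.indep_setD[OF indep])
    moreover have "(\<lambda>\<omega>. (x \<omega>, w \<omega>)) -` (A \<times> B) \<inter> space M = (x -` A \<inter> space M) \<inter> (w -` B \<inter> space M)" by auto
    ultimately show "emeasure (distr M borel x) A * emeasure (distr M borel w) B
      = emeasure (distr M (borel \<Otimes>\<^sub>M borel) (\<lambda>\<omega>. (x \<omega>, w \<omega>))) (A \<times> B)"
      by (simp add: emeasure_distr M.emeasure_eq_measure flip: ennreal_mult)
  qed (auto intro: X.sigma_finite_measure_axioms W.sigma_finite_measure_axioms cong: sets_pair_measure_cong)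
  have "(\<integral>\<^sup>+\<omega>. g (x \<omega>) (w \<omega>) \<partial>M) = (\<integral>\<^sup>+v. (\<lambda>(a, b). g a b) v \<partial>distr M (borel \<Otimes>\<^sub>M borel) (\<lambda>\<omega>. (x \<omega>, w \<omega>)))"
    by (subst nn_integral_distr) simp_all
  also have "\<dots> = (\<integral>\<^sup>+a. \<integral>\<^sup>+b. g a b \<partial>distr M borel w \<partial>distr M borel x)"
    unfolding eq[symmetric] by (subst W.nn_integral_fst[symmetric]) simp_all
  also have "\<dots> = (\<integral>\<^sup>+a. (\<Sum>l\<in>L. ennreal (q l) * (\<integral>\<^sup>+z. g a (un l + gauss_factor (Cn l) *v z) \<partial>std_gauss)) \<partial>distr M borel x)"
  proof (intro nn_integral_cong nn_integral_gaussian_mixture[OF w M L])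
    show "g a \<in> borel_measurable borel" for a using measurable_Pair2[OF g', of a] by simp
  qed
  also have "\<dots> = (\<Sum>k\<in>K. ennreal (p k) * (\<integral>\<^sup>+z'. (\<Sum>l\<in>L. ennreal (q l) *
      (\<integral>\<^sup>+z. g (ux k + gauss_factor (Cx k) *v z') (un l + gauss_factor (Cn l) *v z) \<partial>std_gauss)) \<partial>std_gauss))"
    by (rule nn_integral_gaussian_mixture[OF x M K]) measurable
  also have "\<dots> = (\<Sum>k\<in>K. \<Sum>l\<in>L. ennreal (p k * q l) *
    (\<integral>\<^sup>+v. g (ux k + gauss_factor (Cx k) *v fst v) (un l + gauss_factor (Cn l) *v snd v) \<partial>std_gauss))"
  proof (intro sum.cong refl)
    fix k assume k: "k \<in> K"
    have "(\<integral>\<^sup>+z'. (\<Sum>l\<in>L. ennreal (q l) *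
      (\<integral>\<^sup>+z. g (ux k + gauss_factor (Cx k) *v z') (un l + gauss_factor (Cn l) *v z) \<partial>std_gauss)) \<partial>std_gauss)
     = (\<Sum>l\<in>L. ennreal (q l) * (\<integral>\<^sup>+z'. 
      (\<integral>\<^sup>+z. g (ux k + gauss_factor (Cx k) *v z') (un l + gauss_factor (Cn l) *v z) \<partial>std_gauss) \<partial>std_gauss))"
      by (subst nn_integral_sum) (simp_all add: nn_integral_cmult)
    also have "\<dots> = (\<Sum>l\<in>L. ennreal (q l) * 
      (\<integral>\<^sup>+v. g (ux k + gauss_factor (Cx k) *v fst v) (un l + gauss_factor (Cn l) *v snd v) \<partial>std_gauss))"
    proof (intro sum.cong refl arg_cong2[where f="(*)"])
      fix l
      have "(\<lambda>v. g (ux k + gauss_factor (Cx k) *v fst v) (un l + gauss_factor (Cn l) *v snd v)) \<in> borel_measurable (borel \<Otimes>\<^sub>M borel)"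
        by measurable
      then show "(\<integral>\<^sup>+z'. (\<integral>\<^sup>+z. g (ux k + gauss_factor (Cx k) *v z') (un l + gauss_factor (Cn l) *v z) \<partial>std_gauss) \<partial>std_gauss)
        = (\<integral>\<^sup>+v. g (ux k + gauss_factor (Cx k) *v fst v) (un l + gauss_factor (Cn l) *v snd v) \<partial>std_gauss)"
        by (subst nn_integral_std_gauss_pair(1)) (simp_all add: borel_prod)
    qed
    finally show "ennreal (p k) * (\<integral>\<^sup>+z'. (\<Sum>l\<in>L. ennreal (q l) *
      (\<integral>\<^sup>+z. g (ux k + gauss_factor (Cx k) *v z') (un l + gauss_factor (Cn l) *v z) \<partial>std_gauss)) \<partial>std_gauss)
      = (\<Sum>l\<in>L. ennreal (p k * q l) *
      (\<integral>\<^sup>+v. g (ux k + gauss_factor (Cx k) *v fst v) (un l + gauss_factor (Cn l) *v snd v) \<partial>std_gauss))"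
      using K(2)[OF k] L(2) by (simp add: sum_distrib_left mult.assoc ennreal_mult cong: sum.cong)
  qed
  finally show ?thesis .
qed

section \<open>Moments of mixtures\<close>

text \<open>
  The cross term \<open>2 * (\<Sum>i. w i *\<^sub>R (g i - m)) \<bullet> (m - h)\<close> vanishes because \<open>m\<close> is the weighted mean. The mean is
  given by a product instead of a quotient, so that the identity covers a total weight of zero.
\<close>

lemma weighted_parallel_axis:
  fixes g :: "'i \<Rightarrow> 'a::real_inner"
  assumes "(\<Sum>i\<in>I. w i *\<^sub>R g i) = (\<Sum>i\<in>I. w i) *\<^sub>R m"
  shows "(\<Sum>i\<in>I. w i * (norm (g i - h))\<^sup>2) = (\<Sum>i\<in>I. w i * (norm (g i - m))\<^sup>2) + (\<Sum>i\<in>I. w i) * (norm (m - h))\<^sup>2"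
proof -
  have "w i * (norm (g i - h))\<^sup>2 = w i * (norm (g i - m))\<^sup>2 + w i * (norm (m - h))\<^sup>2 + 2 * ((w i *\<^sub>R g i - w i *\<^sub>R m) \<bullet> (m - h))" for i
    by (simp add: power2_norm_eq_inner inner_diff_left inner_diff_right inner_commute algebra_simps)
  then have "(\<Sum>i\<in>I. w i * (norm (g i - h))\<^sup>2) = (\<Sum>i\<in>I. w i * (norm (g i - m))\<^sup>2) + (\<Sum>i\<in>I. w i) * (norm (m - h))\<^sup>2
    + 2 * (((\<Sum>i\<in>I. w i *\<^sub>R g i) - (\<Sum>i\<in>I. w i) *\<^sub>R m) \<bullet> (m - h))"
    by (simp add: sum.distrib sum_distrib_right sum_distrib_left[symmetric] inner_sum_left[symmetric] sum_subtractf scaleR_sum_left)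
  then show ?thesis by (simp add: assms)
qed

text \<open>
  The inner products of \<open>a k\<close> and \<open>b l\<close> cancel because the \<open>b l\<close> have weighted mean zero. This is the additivity
  of variances for two independent mixtures; \<open>s k\<close> and \<open>t l\<close> stand for the variances within the components.
\<close>

lemma sum_product_weights_norm_sq:
  fixes a :: "'k \<Rightarrow> 'v::real_inner" and b :: "'l \<Rightarrow> 'v" and p s :: "'k \<Rightarrow> real" and q t :: "'l \<Rightarrow> real"
  assumes p: "(\<Sum>k\<in>K. p k) = 1" and q: "(\<Sum>l\<in>L. q l) = 1" and b: "(\<Sum>l\<in>L. q l *\<^sub>R b l) = 0"
  shows "(\<Sum>k\<in>K. \<Sum>l\<in>L. p k * q l * (s k + t l + (norm (a k + b l))\<^sup>2))
    = (\<Sum>k\<in>K. p k * (s k + (norm (a k))\<^sup>2)) + (\<Sum>l\<in>L. q l * (t l + (norm (b l))\<^sup>2))" (is "_ = _ + ?T")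
proof -
  have inner: "(\<Sum>l\<in>L. q l * (norm (a k + b l))\<^sup>2) = (\<Sum>l\<in>L. q l * (norm (b l))\<^sup>2) + (norm (a k))\<^sup>2" for k
    using weighted_parallel_axis[of q b L 0 "- a k"] b q by (simp add: add.commute)
  have "(\<Sum>l\<in>L. p k * q l * (s k + t l + (norm (a k + b l))\<^sup>2)) = p k * (s k + (norm (a k))\<^sup>2) + p k * ?T" for k
  proof -
    have "(\<Sum>l\<in>L. p k * q l * (s k + t l + (norm (a k + b l))\<^sup>2))
      = p k * (\<Sum>l\<in>L. q l * s k + q l * t l + q l * (norm (a k + b l))\<^sup>2)"
      by (simp add: sum_distrib_left algebra_simps)
    also have "(\<Sum>l\<in>L. q l * s k + q l * t l + q l * (norm (a k + b l))\<^sup>2)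
      = (\<Sum>l\<in>L. q l) * s k + (\<Sum>l\<in>L. q l * t l) + (\<Sum>l\<in>L. q l * (norm (a k + b l))\<^sup>2)"
      by (simp add: sum.distrib sum_distrib_right)
    also have "\<dots> = (s k + (norm (a k))\<^sup>2) + ?T"
      by (simp add: inner q sum.distrib distrib_left)
    finally show ?thesis by (simp add: distrib_left)
  qed
  then show ?thesis by (simp add: sum.distrib p flip: sum_distrib_right)
qed

lemma outer_product_nth: "outer_product u v $ i $ j = u $ i * v $ j"
  by (simp add: outer_product_def columnvector_def rowvector_def matrix_matrix_mult_def UNIV_1)

text \<open>
  The law of total covariance: within-component covariance plus the covariance of the component means.
\<close>

lemma mixture_cov_centered:
  assumes "(\<Sum>k\<in>K. p k) = 1"
  shows "mixture_cov K p u C = (\<Sum>k\<in>K. p k *\<^sub>R (C k + outer_product (u k - mixture_mean K p u) (u k - mixture_mean K p u)))"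
proof -
  let ?m = "mixture_mean K p u"
  have m: "?m $ i = (\<Sum>k\<in>K. p k * u k $ i)" for i
    by (simp add: mixture_mean_def)
  have "(\<Sum>k\<in>K. p k * (C k $ i $ j + (u k $ i - ?m $ i) * (u k $ j - ?m $ j)))
      = (\<Sum>k\<in>K. p k * (C k $ i $ j + u k $ i * u k $ j)) - ?m $ i * ?m $ j" for i j
  proof -
    have "(\<Sum>k\<in>K. p k * (C k $ i $ j + (u k $ i - ?m $ i) * (u k $ j - ?m $ j)))
      = (\<Sum>k\<in>K. p k * (C k $ i $ j + u k $ i * u k $ j)) - (\<Sum>k\<in>K. p k * u k $ i) * ?m $ j
         - ?m $ i * (\<Sum>k\<in>K. p k * u k $ j) + (\<Sum>k\<in>K. p k) * (?m $ i * ?m $ j)"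
      by (simp add: sum_distrib_left sum_distrib_right algebra_simps sum.distrib sum_subtractf)
    then show ?thesis by (simp add: m[symmetric] assms)
  qed
  then show ?thesis
    by (simp add: mixture_cov_def vec_eq_iff outer_product_nth)
qed

lemma quadratic_form_outer_product: "v \<bullet> (outer_product u u *v v) = (v \<bullet> u)\<^sup>2"
  by (simp add: inner_vec_def matrix_vector_mult_def outer_product_nth power2_eq_square sum_product sum_distrib_left ac_simps)

lemma trace_congruence_outer_product:
  fixes P :: "real^'n^'k"
  shows "trace (P ** outer_product u u ** transpose P) = (norm (P *v u))\<^sup>2"
proof -
  have "P ** outer_product u u ** transpose P = outer_product (P *v u) (P *v u)"
    by (simp add: vec_eq_iff matrix_matrix_mult_def outer_product_nth transpose_def matrix_vector_mult_def sum_product sum_distrib_left sum_distrib_right ac_simps)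
  then show ?thesis
    by (simp add: trace_def outer_product_nth power2_norm_eq_inner inner_vec_def)
qed

lemma linear_trace_congruence: "linear (\<lambda>C. trace (P ** C ** transpose P))" for P :: "real^'n^'k"
proof (rule linearI)
  show "trace (P ** (c *\<^sub>R C) ** transpose P) = c *\<^sub>R trace (P ** C ** transpose P)" for c C
    by (simp add: trace_def matrix_matrix_mult_def sum_distrib_left sum_distrib_right ac_simps)
qed (simp add: matrix_add_ldistrib matrix_add_rdistrib trace_add)

lemma linear_quadratic_form: "linear (\<lambda>C. v \<bullet> (C *v v))" for v :: "real^'n"
  by (rule linearI) (simp_all add: matrix_vector_mult_add_rdistrib inner_add_right scaleR_matrix_vector_assoc[symmetric])

lemma trace_congruence_mixture_cov:
  fixes P :: "real^'n^'k"
  assumes "(\<Sum>k\<in>K. p k) = 1"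
  shows "trace (P ** mixture_cov K p u C ** transpose P)
    = (\<Sum>k\<in>K. p k * (trace (P ** C k ** transpose P) + (norm (P *v u k - P *v mixture_mean K p u))\<^sup>2))"
  unfolding mixture_cov_centered[OF assms] linear_sum[OF linear_trace_congruence]
    linear_scale[OF linear_trace_congruence] linear_add[OF linear_trace_congruence]
  by (simp add: trace_congruence_outer_product matrix_vector_mult_diff_distrib)

lemma quadratic_form_mixture_cov:
  assumes "(\<Sum>k\<in>K. p k) = 1"
  shows "v \<bullet> (mixture_cov K p u C *v v) = (\<Sum>k\<in>K. p k * (v \<bullet> (C k *v v) + (v \<bullet> (u k - mixture_mean K p u))\<^sup>2))"
  unfolding mixture_cov_centered[OF assms] linear_sum[OF linear_quadratic_form]
    linear_scale[OF linear_quadratic_form] linear_add[OF linear_quadratic_form]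
  by (simp add: quadratic_form_outer_product)

lemma quadratic_form_mixture_cov_ge:
  assumes "finite K" "\<And>k. k \<in> K \<Longrightarrow> 0 \<le> p k" "(\<Sum>k\<in>K. p k) = 1" "\<And>k. k \<in> K \<Longrightarrow> pos_semidef (C k)" "k \<in> K"
  shows "p k * (v \<bullet> (C k *v v)) \<le> v \<bullet> (mixture_cov K p u C *v v)"
proof -
  let ?t = "\<lambda>k. p k * (v \<bullet> (C k *v v) + (v \<bullet> (u k - mixture_mean K p u))\<^sup>2)"
  have "p k * (v \<bullet> (C k *v v)) \<le> ?t k"
    using assms by (intro mult_left_mono) auto
  also have "\<dots> \<le> (\<Sum>k\<in>K. ?t k)"
    using assms by (intro member_le_sum) (auto simp: pos_semidef_def)
  finally show ?thesis by (simp add: quadratic_form_mixture_cov[OF assms(3)])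
qed

lemma positive_weight_exists:
  fixes p :: "'k \<Rightarrow> real"
  assumes "\<And>k. k \<in> K \<Longrightarrow> 0 \<le> p k" "(\<Sum>k\<in>K. p k) = 1"
  obtains k where "k \<in> K" "0 < p k"
  using assms by (metis less_eq_real_def sum.neutral zero_neq_one)

text \<open>
  By the law of total covariance the overall output covariance dominates \<open>p k\<close> times the \<open>Cx k\<close> part plus
  \<open>q l\<close> times the \<open>Cn l\<close> part for every \<open>k\<close> and \<open>l\<close>. For positive weights, a vector in its kernel is
  therefore in the kernel of the invertible component covariance.
\<close>

lemma invertible_mixture_output_cov:
  fixes H :: "real^'n^'m"
  assumes K: "finite K" "\<And>k. k \<in> K \<Longrightarrow> 0 \<le> p k" "(\<Sum>k\<in>K. p k) = 1"
    and L: "finite L" "\<And>l. l \<in> L \<Longrightarrow> 0 \<le> q l" "(\<Sum>l\<in>L. q l) = 1"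
    and Cx: "\<And>k. k \<in> K \<Longrightarrow> pos_semidef (Cx k)" and Cn: "\<And>l. l \<in> L \<Longrightarrow> pos_semidef (Cn l)"
    and inv: "\<And>k l. k \<in> K \<Longrightarrow> l \<in> L \<Longrightarrow> invertible (H ** Cx k ** transpose H + Cn l)"
  shows "invertible (H ** mixture_cov K p ux Cx ** transpose H + mixture_cov L q un Cn)"
proof -
  let ?M = "H ** mixture_cov K p ux Cx ** transpose H + mixture_cov L q un Cn"
  obtain k where k: "k \<in> K" "0 < p k" using positive_weight_exists[of K p] K by blast
  obtain l where l: "l \<in> L" "0 < q l" using positive_weight_exists[of L q] L by blast
  let ?C = "H ** Cx k ** transpose H + Cn l"
  have psd: "pos_semidef ?C" using k l by (intro pos_semidef_congruence_add Cx Cn)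
  have "v = 0" if "?M *v v = 0" for v
  proof -
    let ?a = "transpose H *v v"
    have "?a \<bullet> (mixture_cov K p ux Cx *v ?a) + v \<bullet> (mixture_cov L q un Cn *v v) = 0"
      by (simp only: quadratic_form_congruence_add[symmetric] that inner_zero_right)
    moreover have "p k * (?a \<bullet> (Cx k *v ?a)) \<le> ?a \<bullet> (mixture_cov K p ux Cx *v ?a)"
      by (rule quadratic_form_mixture_cov_ge[OF K Cx k(1)])
    moreover have "q l * (v \<bullet> (Cn l *v v)) \<le> v \<bullet> (mixture_cov L q un Cn *v v)"
      by (rule quadratic_form_mixture_cov_ge[OF L Cn l(1)])
    moreover have "0 \<le> ?a \<bullet> (Cx k *v ?a)" "0 \<le> v \<bullet> (Cn l *v v)"
      using Cx[OF k(1)] Cn[OF l(1)] unfolding pos_semidef_def by blast+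
    moreover from this have "0 \<le> p k * (?a \<bullet> (Cx k *v ?a))" "0 \<le> q l * (v \<bullet> (Cn l *v v))"
      using k l by (auto intro: mult_nonneg_nonneg simp del: vector_transpose_matrix)
    ultimately have "p k * (?a \<bullet> (Cx k *v ?a)) = 0" "q l * (v \<bullet> (Cn l *v v)) = 0" by linarith+
    then have "v \<bullet> (?C *v v) = 0"
      using k l unfolding quadratic_form_congruence_add by (simp del: vector_transpose_matrix)
    then have "?C *v v = 0" by (rule pos_semidef_quadratic_zero[OF psd])
    moreover have "matrix_inv ?C *v (?C *v v) = v"
      by (simp only: matrix_vector_mul_assoc matrix_inv_mult(2)[OF inv[OF k(1) l(1)]] matrix_vector_mul_lid)
    ultimately show ?thesis by simp
  qed
  then show ?thesis
    by (simp add: invertible_left_inverse matrix_left_invertible_ker)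
qed

lemma ennreal_sum_le: "ennreal (\<Sum>i\<in>I. f i) \<le> (\<Sum>i\<in>I. ennreal (f i))"
proof -
  have "ennreal (\<Sum>i\<in>I. f i) \<le> ennreal (\<Sum>i\<in>I. max 0 (f i))"
    by (intro ennreal_leI sum_mono) simp
  also have "\<dots> = (\<Sum>i\<in>I. ennreal (f i))"
    by (subst sum_ennreal[symmetric]) (simp_all only: ennreal_max_0 max.cobounded1)
  finally show ?thesis .
qed

section \<open>The MMSE estimator of a Gaussian mixture\<close>

locale gaussian_mixture_model = prob_space M for M :: "'a measure" +
  fixes H :: "real^'n^'m" and x :: "'a \<Rightarrow> real^'n" and w :: "'a \<Rightarrow> real^'m"
    and K :: "'k set" and p :: "'k \<Rightarrow> real" and ux :: "'k \<Rightarrow> real^'n" and Cx :: "'k \<Rightarrow> real^'n^'n"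
    and L :: "'l set" and q :: "'l \<Rightarrow> real" and un :: "'l \<Rightarrow> real^'m" and Cn :: "'l \<Rightarrow> real^'m^'m"
  assumes K: "finite K" "\<And>k. k \<in> K \<Longrightarrow> 0 \<le> p k" "(\<Sum>k\<in>K. p k) = 1"
    and L: "finite L" "\<And>l. l \<in> L \<Longrightarrow> 0 \<le> q l" "(\<Sum>l\<in>L. q l) = 1"
    and Cx: "\<And>k. k \<in> K \<Longrightarrow> pos_semidef (Cx k)" and Cn: "\<And>l. l \<in> L \<Longrightarrow> pos_semidef (Cn l)"
    and x_law: "has_gaussian_mixture_law M x K p ux Cx" and w_law: "has_gaussian_mixture_law M w L q un Cn"
    and indep: "indep_set (sets (vimage_algebra (space M) x borel)) (sets (vimage_algebra (space M) w borel))"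
    and inv: "\<And>k l. k \<in> K \<Longrightarrow> l \<in> L \<Longrightarrow> invertible (H ** Cx k ** transpose H + Cn l)"
begin

definition "y \<omega> = H *v x \<omega> + w \<omega>"

definition "Cyy k l = H ** Cx k ** transpose H + Cn l"

definition "gain k l = Cx k ** transpose H ** matrix_inv (Cyy k l)"

text \<open>
  The posterior mean of \<open>x\<close> given \<open>y = z\<close> when \<open>x\<close> and \<open>w\<close> come from the components \<open>k\<close> and \<open>l\<close>.
\<close>

definition "component_mean k l z = ux k + gain k l *v (z - (H *v ux k + un l))"

definition "component_mse k l = trace (Cx k - gain k l ** H ** Cx k)"

text \<open>
  The joint density of the pair of components \<open>(k, l)\<close> and the output: the weight of the pair is included.
\<close>

definition "component_density k l z = p k * q l * gaussian_density (H *v ux k + un l) (Cyy k l) z"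

definition "output_density z = (\<Sum>k\<in>K. \<Sum>l\<in>L. component_density k l z)"

definition "posterior_mean z =
  (\<Sum>k\<in>K. \<Sum>l\<in>L. (component_density k l z / output_density z) *\<^sub>R component_mean k l z)"

definition "mse h = (\<integral>\<^sup>+\<omega>. ennreal ((norm (x \<omega> - h (y \<omega>)))\<^sup>2) \<partial>M)"

lemma measurable_signals [measurable]: "x \<in> borel_measurable M" "w \<in> borel_measurable M" "y \<in> borel_measurable M"
proof -
  show [measurable]: "x \<in> borel_measurable M" "w \<in> borel_measurable M"
    using x_law w_law by (simp_all add: has_gaussian_mixture_law_def)
  show "y \<in> borel_measurable M" unfolding y_def by measurable
qed

lemma measurable_components [measurable]:
  "component_mean k l \<in> borel_measurable borel" "component_density k l \<in> borel_measurable borel"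
  "output_density \<in> borel_measurable borel" "posterior_mean \<in> borel_measurable borel"
proof -
  show [measurable]: "component_mean k l \<in> borel_measurable borel" "component_density k l \<in> borel_measurable borel" for k l
    unfolding component_mean_def component_density_def by measurable
  show [measurable]: "output_density \<in> borel_measurable borel" unfolding output_density_def by measurable
  show "posterior_mean \<in> borel_measurable borel" unfolding posterior_mean_def by measurable
qed

lemma component_density_nonneg: "k \<in> K \<Longrightarrow> l \<in> L \<Longrightarrow> 0 \<le> component_density k l z"
  unfolding component_density_def Cyy_def
  by (intro mult_nonneg_nonneg K L gaussian_density_nonneg pos_semidef_congruence_add Cx Cn)

lemma output_density_nonneg: "0 \<le> output_density z"
  unfolding output_density_def by (intro sum_nonneg component_density_nonneg)

text \<open>
  Stated as a product so that it also holds at points where the output density vanishes.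
\<close>

lemma posterior_mean_weighted:
  "(\<Sum>k\<in>K. \<Sum>l\<in>L. component_density k l z *\<^sub>R component_mean k l z) = output_density z *\<^sub>R posterior_mean z"
proof (cases "output_density z = 0")
  case True
  have "component_density k l z = 0" if "k \<in> K" "l \<in> L" for k l
  proof -
    have "(\<Sum>l\<in>L. component_density k l z) = 0"
      using True that sum_nonneg_eq_0_iff[OF K(1), of "\<lambda>k. \<Sum>l\<in>L. component_density k l z"]
      by (simp add: output_density_def sum_nonneg component_density_nonneg)
    then show ?thesis
      using that sum_nonneg_eq_0_iff[OF L(1), of "\<lambda>l. component_density k l z"]
      by (simp add: component_density_nonneg)
  qed
  then show ?thesis using True by simp
next
  case False
  then show ?thesis
    by (simp add: posterior_mean_def scaleR_sum_right)
qed

lemmas expectation_split = nn_integral_independent_mixtures[OF prob_space_axioms K L x_law w_law indep]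

lemma output_law:
  assumes [measurable]: "g \<in> borel_measurable borel"
  shows "(\<integral>\<^sup>+\<omega>. g (y \<omega>) \<partial>M) = (\<integral>\<^sup>+z. ennreal (output_density z) * g z \<partial>lborel)"
proof -
  have "(\<integral>\<^sup>+\<omega>. g (y \<omega>) \<partial>M) = (\<Sum>k\<in>K. \<Sum>l\<in>L. ennreal (p k * q l) *
    (\<integral>\<^sup>+v. g (H *v (ux k + gauss_factor (Cx k) *v fst v) + (un l + gauss_factor (Cn l) *v snd v)) \<partial>std_gauss))"
    unfolding y_def by (rule expectation_split) measurable
  also have "\<dots> = (\<Sum>k\<in>K. \<Sum>l\<in>L. (\<integral>\<^sup>+z. ennreal (component_density k l z) * g z \<partial>lborel))"
  proof (intro sum.cong refl)
    fix k l assume kl: "k \<in> K" "l \<in> L"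
    show "ennreal (p k * q l) *
        (\<integral>\<^sup>+v. g (H *v (ux k + gauss_factor (Cx k) *v fst v) + (un l + gauss_factor (Cn l) *v snd v)) \<partial>std_gauss)
      = (\<integral>\<^sup>+z. ennreal (component_density k l z) * g z \<partial>lborel)"
      using K(2)[OF kl(1)] L(2)[OF kl(2)]
      by (subst component_output_density[OF gauss_factor[OF Cx] gauss_factor[OF Cn] Cx Cn inv])
         (simp_all add: kl component_density_def Cyy_def ennreal_mult' mult.assoc nn_integral_cmult)
  qed
  also have "\<dots> = (\<integral>\<^sup>+z. ennreal (output_density z) * g z \<partial>lborel)"
    by (simp add: output_density_def component_density_nonneg sum_nonneg sum_distrib_right nn_integral_sum
        flip: sum_ennreal)
  finally show ?thesis .
qed

lemma mse_decomposition:
  assumes [measurable]: "h \<in> borel_measurable borel"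
  shows "mse h = (\<Sum>k\<in>K. \<Sum>l\<in>L. ennreal (p k * q l * component_mse k l))
    + (\<integral>\<^sup>+z. ennreal (\<Sum>k\<in>K. \<Sum>l\<in>L. component_density k l z * (norm (component_mean k l z - h z))\<^sup>2) \<partial>lborel)"
proof -
  have "mse h = (\<Sum>k\<in>K. \<Sum>l\<in>L. ennreal (p k * q l) *
    (\<integral>\<^sup>+v. ennreal ((norm (ux k + gauss_factor (Cx k) *v fst v
        - h (H *v (ux k + gauss_factor (Cx k) *v fst v) + (un l + gauss_factor (Cn l) *v snd v))))\<^sup>2) \<partial>std_gauss))"
    unfolding mse_def y_def
    by (rule expectation_split[where g="\<lambda>a b. ennreal ((norm (a - h (H *v a + b)))\<^sup>2)"]) measurable
  also have "\<dots> = (\<Sum>k\<in>K. \<Sum>l\<in>L. ennreal (p k * q l * component_mse k l)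
      + (\<integral>\<^sup>+z. ennreal (component_density k l z * (norm (component_mean k l z - h z))\<^sup>2) \<partial>lborel))"
  proof (intro sum.cong refl)
    fix k l assume kl: "k \<in> K" "l \<in> L"
    have pq: "0 \<le> p k * q l" using K(2)[OF kl(1)] L(2)[OF kl(2)] by simp
    have density: "ennreal (component_density k l z * (norm (component_mean k l z - h z))\<^sup>2)
      = ennreal (p k * q l) * (ennreal (gaussian_density (H *v ux k + un l) (Cyy k l) z)
           * ennreal ((norm (component_mean k l z - h z))\<^sup>2))" for z
      unfolding component_density_def ennreal_mult''[OF zero_le_power2] ennreal_mult'[OF pq] by (rule mult.assoc)
    have "(\<integral>\<^sup>+v. ennreal ((norm (ux k + gauss_factor (Cx k) *v fst v
        - h (H *v (ux k + gauss_factor (Cx k) *v fst v) + (un l + gauss_factor (Cn l) *v snd v))))\<^sup>2) \<partial>std_gauss)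
      = ennreal (component_mse k l) + (\<integral>\<^sup>+z. ennreal (gaussian_density (H *v ux k + un l) (Cyy k l) z)
           * ennreal ((norm (component_mean k l z - h z))\<^sup>2) \<partial>lborel)"
      unfolding component_mse_def component_mean_def gain_def Cyy_def
      by (rule component_error_decomposition) (simp_all add: kl gauss_factor Cx Cn inv)
    then show "ennreal (p k * q l) * (\<integral>\<^sup>+v. ennreal ((norm (ux k + gauss_factor (Cx k) *v fst v
        - h (H *v (ux k + gauss_factor (Cx k) *v fst v) + (un l + gauss_factor (Cn l) *v snd v))))\<^sup>2) \<partial>std_gauss)
      = ennreal (p k * q l * component_mse k l)
      + (\<integral>\<^sup>+z. ennreal (component_density k l z * (norm (component_mean k l z - h z))\<^sup>2) \<partial>lborel)"
      unfolding density ennreal_mult'[OF pq] by (simp add: distrib_left nn_integral_cmult)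
  qed
  also have "\<dots> = (\<Sum>k\<in>K. \<Sum>l\<in>L. ennreal (p k * q l * component_mse k l))
    + (\<integral>\<^sup>+z. (\<Sum>k\<in>K. \<Sum>l\<in>L. ennreal (component_density k l z * (norm (component_mean k l z - h z))\<^sup>2)) \<partial>lborel)"
    by (simp add: sum.distrib nn_integral_sum del: sum_ennreal)
  finally show ?thesis
    by (simp add: sum_nonneg component_density_nonneg cong: sum.cong)
qed

text \<open>
  For a fixed output \<open>z\<close> the posterior mean is the weighted mean of the component means, so the parallel axis
  identity extracts the squared distance of \<open>h z\<close> from it. The total weight is the density of \<open>y\<close>, which turns
  the extra term into an expectation.
\<close>

lemma mse_pythagoras:
  assumes [measurable]: "h \<in> borel_measurable borel"
  shows "mse h = mse posterior_mean + (\<integral>\<^sup>+\<omega>. ennreal ((norm (posterior_mean (y \<omega>) - h (y \<omega>)))\<^sup>2) \<partial>M)"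
proof -
  have "(\<Sum>k\<in>K. \<Sum>l\<in>L. component_density k l z * (norm (component_mean k l z - h z))\<^sup>2)
    = (\<Sum>k\<in>K. \<Sum>l\<in>L. component_density k l z * (norm (component_mean k l z - posterior_mean z))\<^sup>2)
      + output_density z * (norm (posterior_mean z - h z))\<^sup>2" for z
  proof -
    have "(\<Sum>i\<in>K \<times> L. component_density (fst i) (snd i) z * (norm (component_mean (fst i) (snd i) z - h z))\<^sup>2)
      = (\<Sum>i\<in>K \<times> L. component_density (fst i) (snd i) z * (norm (component_mean (fst i) (snd i) z - posterior_mean z))\<^sup>2)
        + (\<Sum>i\<in>K \<times> L. component_density (fst i) (snd i) z) * (norm (posterior_mean z - h z))\<^sup>2"
      using posterior_mean_weighted[of z]
      by (intro weighted_parallel_axis) (simp add: output_density_def sum.cartesian_product split_beta)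
    then show ?thesis
      by (simp add: output_density_def sum.cartesian_product split_beta)
  qed
  then have "(\<integral>\<^sup>+z. ennreal (\<Sum>k\<in>K. \<Sum>l\<in>L. component_density k l z * (norm (component_mean k l z - h z))\<^sup>2) \<partial>lborel)
    = (\<integral>\<^sup>+z. ennreal (\<Sum>k\<in>K. \<Sum>l\<in>L. component_density k l z * (norm (component_mean k l z - posterior_mean z))\<^sup>2)
        + ennreal (output_density z) * ennreal ((norm (posterior_mean z - h z))\<^sup>2) \<partial>lborel)"
    by (simp add: sum_nonneg component_density_nonneg output_density_nonneg ennreal_mult)
  also have "\<dots> = (\<integral>\<^sup>+z. ennreal (\<Sum>k\<in>K. \<Sum>l\<in>L. component_density k l z * (norm (component_mean k l z - posterior_mean z))\<^sup>2) \<partial>lborel)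
        + (\<integral>\<^sup>+\<omega>. ennreal ((norm (posterior_mean (y \<omega>) - h (y \<omega>)))\<^sup>2) \<partial>M)"
    by (subst output_law[where g="\<lambda>z. ennreal ((norm (posterior_mean z - h z))\<^sup>2)"]) (simp_all add: nn_integral_add)
  finally show ?thesis
    by (simp add: mse_decomposition add.assoc)
qed

lemma mse_posterior_mean_le:
  assumes "h \<in> borel_measurable borel"
  shows "mse posterior_mean \<le> mse h"
  unfolding le_iff_add using mse_pythagoras[OF assms] by blast

text \<open>
  Knowing which components are active can only help: the distances to the component means are nonnegative.
\<close>

lemma mse_lower_bound:
  assumes "h \<in> borel_measurable borel"
  shows "ennreal (\<Sum>k\<in>K. \<Sum>l\<in>L. p k * q l * component_mse k l) \<le> mse h"
proof -
  have "ennreal (\<Sum>k\<in>K. \<Sum>l\<in>L. p k * q l * component_mse k l) \<le> (\<Sum>k\<in>K. ennreal (\<Sum>l\<in>L. p k * q l * component_mse k l))"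
    by (rule ennreal_sum_le)
  also have "\<dots> \<le> (\<Sum>k\<in>K. \<Sum>l\<in>L. ennreal (p k * q l * component_mse k l))"
    by (intro sum_mono ennreal_sum_le)
  also have "\<dots> \<le> mse h" unfolding mse_decomposition[OF assms] by simp
  finally show ?thesis .
qed

definition "Cxx = mixture_cov K p ux Cx"
definition "Cnn = mixture_cov L q un Cn"
definition "linear_mse = trace (Cxx - Cxx ** transpose H ** matrix_inv (H ** Cxx ** transpose H + Cnn) ** H ** Cxx)"

text \<open>
  The best affine estimator for the overall means and covariances. Its error \<open>P (x - E x) + Q (w - E w)\<close>, with
  \<open>P = 1 - V H\<close> and \<open>Q = - V\<close>, is affine, so its second moment involves the mixtures only through their overall
  covariances. Nonnegativity is recorded because it is lost in \<open>ennreal linear_mse\<close>.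
\<close>

lemma linear_estimator_mse:
  obtains h where "h \<in> borel_measurable borel" "mse h = ennreal linear_mse" "0 \<le> linear_mse"
proof -
  let ?ux = "mixture_mean K p ux" and ?un = "mixture_mean L q un"
  let ?M = "H ** Cxx ** transpose H + Cnn"
  define V where "V = Cxx ** transpose H ** matrix_inv ?M"
  let ?P = "mat 1 - V ** H" and ?Q = "- V"
  let ?c = "?P *v ?ux + ?Q *v ?un"
  define h where "h = (\<lambda>z. V *v z + ?c)"
  have h[measurable]: "h \<in> borel_measurable borel" unfolding h_def by measurable
  have error: "a - h (H *v a + b) = ?P *v a + ?Q *v b - ?c" for a b
    by (simp add: h_def matrix_vector_mult_diff_rdistrib matrix_vector_right_distrib matrix_vector_mul_assoc
        matrix_vector_mult_uminus)
  let ?a = "\<lambda>k. ?P *v ux k - ?P *v ?ux" and ?b = "\<lambda>l. ?Q *v un l - ?Q *v ?un"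
  let ?s = "\<lambda>k. trace (?P ** Cx k ** transpose ?P)" and ?t = "\<lambda>l. trace (?Q ** Cn l ** transpose ?Q)"
  have nonneg: "0 \<le> p k * q l * (?s k + ?t l + (norm (?a k + ?b l))\<^sup>2)" if "k \<in> K" "l \<in> L" for k l
    using that by (intro mult_nonneg_nonneg add_nonneg_nonneg trace_congruence_nonneg K L Cx Cn zero_le_power2)
  have "(\<Sum>k\<in>K. \<Sum>l\<in>L. p k * q l * (?s k + ?t l + (norm (?a k + ?b l))\<^sup>2))
    = trace (?P ** Cxx ** transpose ?P) + trace (?Q ** Cnn ** transpose ?Q)"
  proof -
    \<comment> \<open>The noise deviations are centred, which decouples the sums over \<open>k\<close> and \<open>l\<close>.\<close>
    have b0: "(\<Sum>l\<in>L. q l *\<^sub>R ?b l) = 0"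
    proof -
      have "(\<Sum>l\<in>L. q l *\<^sub>R ?b l) = ?Q *v (\<Sum>l\<in>L. q l *\<^sub>R un l) - (\<Sum>l\<in>L. q l) *\<^sub>R (?Q *v ?un)"
        by (simp only: scaleR_diff_right sum_subtractf scaleR_sum_left linear_sum[OF matrix_vector_mul_linear] matrix_vector_mult_scaleR)
      then show ?thesis by (simp add: L(3) mixture_mean_def)
    qed
    show ?thesis
      unfolding Cxx_def Cnn_def trace_congruence_mixture_cov[OF K(3)] trace_congruence_mixture_cov[OF L(3)]
      by (rule sum_product_weights_norm_sq[OF K(3) L(3) b0])
  qed
  also have "\<dots> = linear_mse"
  proof -
    have "invertible ?M"
      unfolding Cxx_def Cnn_def by (rule invertible_mixture_output_cov[OF K L Cx Cn inv])
    then have "?P ** Cxx ** transpose ?P + V ** Cnn ** transpose V = Cxx - V ** H ** Cxx"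
      unfolding V_def by (rule linear_estimator_error_covariance)
    moreover have "?Q ** Cnn ** transpose ?Q = V ** Cnn ** transpose V"
      by (simp add: matrix_matrix_mult_def transpose_def vec_eq_iff sum_negf)
    ultimately show ?thesis by (simp add: linear_mse_def V_def flip: trace_add)
  qed
  finally have sum_eq: "(\<Sum>k\<in>K. \<Sum>l\<in>L. p k * q l * (?s k + ?t l + (norm (?a k + ?b l))\<^sup>2)) = linear_mse" .
  have "mse h = (\<Sum>k\<in>K. \<Sum>l\<in>L. ennreal (p k * q l) *
    (\<integral>\<^sup>+v. ennreal ((norm (?P *v (ux k + gauss_factor (Cx k) *v fst v) + ?Q *v (un l + gauss_factor (Cn l) *v snd v) - ?c))\<^sup>2) \<partial>std_gauss))"
    unfolding mse_def y_def error
    by (rule expectation_split[where g="\<lambda>a b. ennreal ((norm (?P *v a + ?Q *v b - ?c))\<^sup>2)"]) measurable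
  also have "\<dots> = (\<Sum>k\<in>K. \<Sum>l\<in>L. ennreal (p k * q l * (?s k + ?t l + (norm (?a k + ?b l))\<^sup>2)))"
  proof (intro sum.cong refl)
    fix k l assume kl: "k \<in> K" "l \<in> L"
    have "?P *v ux k + ?Q *v un l - ?c = ?a k + ?b l" by simp
    then show "ennreal (p k * q l) *
      (\<integral>\<^sup>+v. ennreal ((norm (?P *v (ux k + gauss_factor (Cx k) *v fst v) + ?Q *v (un l + gauss_factor (Cn l) *v snd v) - ?c))\<^sup>2) \<partial>std_gauss)
      = ennreal (p k * q l * (?s k + ?t l + (norm (?a k + ?b l))\<^sup>2))"
      using K(2)[OF kl(1)] L(2)[OF kl(2)]
      by (simp only: component_affine_error[OF gauss_factor[OF Cx[OF kl(1)]] gauss_factor[OF Cn[OF kl(2)]] Cx[OF kl(1)] Cn[OF kl(2)]]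
           ennreal_mult' mult_nonneg_nonneg)
  qed
  also have "\<dots> = ennreal (\<Sum>k\<in>K. \<Sum>l\<in>L. p k * q l * (?s k + ?t l + (norm (?a k + ?b l))\<^sup>2))"
    by (simp add: nonneg sum_nonneg)
  finally have "mse h = ennreal linear_mse" unfolding sum_eq .
  moreover have "0 \<le> linear_mse" unfolding sum_eq[symmetric] by (intro sum_nonneg nonneg)
  ultimately show thesis using that h by blast
qed

lemma mse_upper_bound: "mse posterior_mean \<le> ennreal linear_mse"
proof -
  obtain h where h: "h \<in> borel_measurable borel" "mse h = ennreal linear_mse" by (rule linear_estimator_mse)
  then show ?thesis using mse_posterior_mean_le[OF h(1)] by simp
qed

lemma is_mmse_posterior_mean: "is_mmse_estimator M x y posterior_mean"
  unfolding is_mmse_estimator_def mse_def[symmetric] by (simp add: mse_posterior_mean_le)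

text \<open>
  The error of the posterior mean is finite, so it can be cancelled from the Pythagorean identity for another
  optimal estimator \<open>g\<close>, which leaves \<open>E \<parallel>posterior_mean y - g y\<parallel>\<^sup>2 = 0\<close>.
\<close>

lemma mmse_estimator_unique:
  assumes "is_mmse_estimator M x y g"
  shows "AE \<omega> in M. g (y \<omega>) = posterior_mean (y \<omega>)"
proof -
  have g[measurable]: "g \<in> borel_measurable borel" and "mse g \<le> mse posterior_mean"
    using assms by (auto simp: is_mmse_estimator_def mse_def)
  moreover have "mse posterior_mean < \<top>" by (rule le_less_trans[OF mse_upper_bound]) (rule ennreal_less_top)
  ultimately have "(\<integral>\<^sup>+\<omega>. ennreal ((norm (posterior_mean (y \<omega>) - g (y \<omega>)))\<^sup>2) \<partial>M) = 0"
    using mse_pythagoras[OF g] ennreal_add_left_cancel_le[of "mse posterior_mean" _ 0]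
    by (auto simp flip: less_top)
  then have "AE \<omega> in M. ennreal ((norm (posterior_mean (y \<omega>) - g (y \<omega>)))\<^sup>2) = 0"
    by (subst (asm) nn_integral_0_iff_AE) simp_all
  then show ?thesis by (rule AE_mp) (auto intro!: AE_I2)
qed

lemma integrable_posterior_error: "integrable M (\<lambda>\<omega>. (norm (x \<omega> - posterior_mean (y \<omega>)))\<^sup>2)"
  and ennreal_posterior_mse: "ennreal (LINT \<omega>|M. (norm (x \<omega> - posterior_mean (y \<omega>)))\<^sup>2) = mse posterior_mean"
proof -
  have "mse posterior_mean < \<infinity>"
    by (rule le_less_trans[OF mse_upper_bound]) simp
  then show int: "integrable M (\<lambda>\<omega>. (norm (x \<omega> - posterior_mean (y \<omega>)))\<^sup>2)"
    unfolding mse_def by (intro integrableI_nonneg) auto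
  show "ennreal (LINT \<omega>|M. (norm (x \<omega> - posterior_mean (y \<omega>)))\<^sup>2) = mse posterior_mean"
    unfolding mse_def by (rule nn_integral_eq_integral[symmetric]) (auto intro: int)
qed

end

theorem theorem1:
  fixes M :: "'a measure"
    and H :: "real^'n^'m"
    and x :: "'a \<Rightarrow> real^'n" and w y :: "'a \<Rightarrow> real^'m"
    and K :: "'k set" and p :: "'k \<Rightarrow> real" and ux :: "'k \<Rightarrow> real^'n" and Cx :: "'k \<Rightarrow> real^'n^'n"
    and L :: "'l set" and q :: "'l \<Rightarrow> real" and un :: "'l \<Rightarrow> real^'m" and Cn :: "'l \<Rightarrow> real^'m^'m"
    and Cyy :: "'k \<Rightarrow> 'l \<Rightarrow> real^'m^'m"
    and f \<alpha> :: "'k \<Rightarrow> 'l \<Rightarrow> real^'m \<Rightarrow> real"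
    and xhat :: "real^'m \<Rightarrow> real^'n"
    and Cxx :: "real^'n^'n" and Cnn :: "real^'m^'m"
  assumes "prob_space M"
    and "finite K" and "\<And>k. k \<in> K \<Longrightarrow> 0 \<le> p k" and "(\<Sum>k\<in>K. p k) = 1"
    and "finite L" and "\<And>l. l \<in> L \<Longrightarrow> 0 \<le> q l" and "(\<Sum>l\<in>L. q l) = 1"
    and "\<And>k. k \<in> K \<Longrightarrow> pos_semidef (Cx k)"
    and "\<And>l. l \<in> L \<Longrightarrow> pos_semidef (Cn l)"
    and "has_gaussian_mixture_law M x K p ux Cx"
    and "has_gaussian_mixture_law M w L q un Cn"
    and "prob_space.indep_set M (sets (vimage_algebra (space M) x borel)) (sets (vimage_algebra (space M) w borel))"
    and y: "\<And>\<omega>. y \<omega> = H *v x \<omega> + w \<omega>"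
    and Cyy: "\<And>k l. Cyy k l = H ** Cx k ** transpose H + Cn l"
    and "\<And>k l. k \<in> K \<Longrightarrow> l \<in> L \<Longrightarrow> invertible (Cyy k l)"
    and f: "\<And>k l. f k l = gaussian_density (H *v ux k + un l) (Cyy k l)"
    and \<alpha>: "\<And>k l z. \<alpha> k l z = p k * q l * f k l z / (\<Sum>r\<in>K. \<Sum>s\<in>L. p r * q s * f r s z)"
    and xhat: "\<And>z. xhat z = (\<Sum>k\<in>K. \<Sum>l\<in>L. \<alpha> k l z *\<^sub>R
           (ux k + (Cx k ** transpose H ** matrix_inv (Cyy k l)) *v (z - H *v ux k - un l)))"
    and Cxx: "Cxx = mixture_cov K p ux Cx"
    and Cnn: "Cnn = mixture_cov L q un Cn"
  shows "is_mmse_estimator M x y xhat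
       \<and> (\<forall>g. is_mmse_estimator M x y g \<longrightarrow> (AE \<omega> in M. g (y \<omega>) = xhat (y \<omega>)))
       \<and> integrable M (\<lambda>\<omega>. (norm (x \<omega> - xhat (y \<omega>)))\<^sup>2)
       \<and> (\<Sum>k\<in>K. \<Sum>l\<in>L. p k * q l *
             trace (Cx k - Cx k ** transpose H ** matrix_inv (Cyy k l) ** H ** Cx k))
           \<le> (LINT \<omega>|M. (norm (x \<omega> - xhat (y \<omega>)))\<^sup>2)
       \<and> (LINT \<omega>|M. (norm (x \<omega> - xhat (y \<omega>)))\<^sup>2)
           \<le> trace (Cxx - Cxx ** transpose H ** matrix_inv (H ** Cxx ** transpose H + Cnn) ** H ** Cxx)"
proof -
  interpret prob_space M by fact
  interpret G: gaussian_mixture_model M H x w K p ux Cx L q un Cn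
    by unfold_locales (use assms in \<open>simp_all flip: Cyy\<close>)
  have y_eq: "y = G.y" by (simp add: fun_eq_iff y G.y_def)
  have Cyy_eq: "G.Cyy = Cyy" by (simp add: fun_eq_iff Cyy G.Cyy_def)
  have gain: "Cx k ** transpose H ** matrix_inv (Cyy k l) = G.gain k l" for k l
    by (simp add: G.gain_def Cyy_eq)
  have "\<alpha> k l z = G.component_density k l z / G.output_density z" for k l z
    by (simp add: \<alpha> f G.component_density_def G.output_density_def Cyy_eq)
  then have xhat_eq: "xhat = G.posterior_mean"
    by (simp add: fun_eq_iff xhat gain G.posterior_mean_def G.component_mean_def diff_diff_add)
  have lower: "(\<Sum>k\<in>K. \<Sum>l\<in>L. p k * q l *
      trace (Cx k - Cx k ** transpose H ** matrix_inv (Cyy k l) ** H ** Cx k))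
    = (\<Sum>k\<in>K. \<Sum>l\<in>L. p k * q l * G.component_mse k l)"
    by (simp add: gain G.component_mse_def)
  have upper: "trace (Cxx - Cxx ** transpose H ** matrix_inv (H ** Cxx ** transpose H + Cnn) ** H ** Cxx) = G.linear_mse"
    by (simp add: G.linear_mse_def G.Cxx_def G.Cnn_def Cxx Cnn)
  let ?\<epsilon> = "LINT \<omega>|M. (norm (x \<omega> - G.posterior_mean (G.y \<omega>)))\<^sup>2"
  have \<epsilon>: "0 \<le> ?\<epsilon>" by simp
  have "ennreal (\<Sum>k\<in>K. \<Sum>l\<in>L. p k * q l * G.component_mse k l) \<le> ennreal ?\<epsilon>"
    unfolding G.ennreal_posterior_mse by (rule G.mse_lower_bound) simp
  then have le: "(\<Sum>k\<in>K. \<Sum>l\<in>L. p k * q l * G.component_mse k l) \<le> ?\<epsilon>"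
    using \<epsilon> by (simp add: ennreal_le_iff)
  have "0 \<le> G.linear_mse" by (rule G.linear_estimator_mse)
  then have "?\<epsilon> \<le> G.linear_mse"
    using G.mse_upper_bound unfolding G.ennreal_posterior_mse[symmetric] by (simp add: ennreal_le_iff)
  with le show ?thesis
    unfolding y_eq xhat_eq lower upper
    using G.is_mmse_posterior_mean G.mmse_estimator_unique G.integrable_posterior_error by blast
qed

end
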